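(* For a monoid $M$, the following are equivalent: (1) $\Gamma : \mathbf{PSh}(M) \to \mathbf{Set}$ preserves filtered colimits, i.e. the topos $\mathbf{PSh}(M)$ is strongly compact. (2) The terminal right $M$-set $1$ is finitely presentable. (3) $M$ is right-factorably finitely generated.
   Context: For a monoid $M$, $\mathbf{PSh}(M)$ denotes the category of right $M$-sets (the empty one included) and $M$-equivariant maps. $\Gamma : \mathbf{PSh}(M) \to \mathbf{Set}$ is the global sections functor, sending $X$ to its set of fixed points $\{x \in X : xm = x \ \forall m \in M\} \cong \mathrm{Hom}_{\mathbf{PSh}(M)}(1,X)$, where $1$ is the one-element right $M$-set. A Grothendieck topos is strongly compact if its global sections functor preserves filtered colimits. A right $M$-set $B$ is finitely presentable if $\mathrm{Hom}_{\mathbf{PSh}(M)}(B,-) : \mathbf{PSh}(M) \to \mathbf{Set}$ preserves filtered colimits (equivalently, $B$ is a coequalizer of a pair of maps between finitely generated free right $M$-sets). A subset $T \subseteq M$ is right-factorable if whenever $x \in T$, $y \in M$ and $xy \in T$, then $y \in T$. For a nonempty subset $S \subseteq M$, $\langle S \rangle\rangle_M$ denotes the smallest right-factorable submonoid of $M$ containing $S$. $M$ is right-factorably finitely generated if there is a finite (nonempty) subset $S \subseteq M$ with $\langle S \rangle\rangle_M = M$. *)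

theory Defs
  imports "HOL-Algebra.Group" "HOL-Library.Equipollence"
begin

section \<open>Categories, functors and colimits\<close>

record ('o, 'a) category =
  Obj :: "'o set"
  Arr :: "'a set"
  Dom :: "'a \<Rightarrow> 'o"
  Cod :: "'a \<Rightarrow> 'o"
  Id :: "'o \<Rightarrow> 'a"
  Comp :: "'a \<Rightarrow> 'a \<Rightarrow> 'a"  \<comment> \<open>\<open>Comp C g f\<close> is \<open>g\<close> after \<open>f\<close>\<close>

definition Hom :: "('o, 'a) category \<Rightarrow> 'o \<Rightarrow> 'o \<Rightarrow> 'a set" where
  "Hom C a b = {f \<in> Arr C. Dom C f = a \<and> Cod C f = b}"

definition is_category :: "('o, 'a) category \<Rightarrow> bool" where
  "is_category C \<longleftrightarrow>
     (\<forall>f\<in>Arr C. Dom C f \<in> Obj C \<and> Cod C f \<in> Obj C) \<and>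
     (\<forall>a\<in>Obj C. Id C a \<in> Hom C a a) \<and>
     (\<forall>f\<in>Arr C. \<forall>g\<in>Arr C. Cod C f = Dom C g \<longrightarrow> Comp C g f \<in> Hom C (Dom C f) (Cod C g)) \<and>
     (\<forall>f\<in>Arr C. Comp C f (Id C (Dom C f)) = f \<and> Comp C (Id C (Cod C f)) f = f) \<and>
     (\<forall>f\<in>Arr C. \<forall>g\<in>Arr C. \<forall>h\<in>Arr C. Cod C f = Dom C g \<and> Cod C g = Dom C h \<longrightarrow>
        Comp C h (Comp C g f) = Comp C (Comp C h g) f)"

record ('o, 'a, 'p, 'b) cat_map =
  FObj :: "'o \<Rightarrow> 'p"
  FArr :: "'a \<Rightarrow> 'b"

definition is_functor ::
    "('o, 'a) category \<Rightarrow> ('p, 'b) category \<Rightarrow> ('o, 'a, 'p, 'b) cat_map \<Rightarrow> bool" where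
  "is_functor C E F \<longleftrightarrow>
     (\<forall>a\<in>Obj C. FObj F a \<in> Obj E) \<and>
     (\<forall>f\<in>Arr C. FArr F f \<in> Hom E (FObj F (Dom C f)) (FObj F (Cod C f))) \<and>
     (\<forall>a\<in>Obj C. FArr F (Id C a) = Id E (FObj F a)) \<and>
     (\<forall>f\<in>Arr C. \<forall>g\<in>Arr C. Cod C f = Dom C g \<longrightarrow>
        FArr F (Comp C g f) = Comp E (FArr F g) (FArr F f))"

definition functor_comp ::
    "('p, 'b, 'q, 'c) cat_map \<Rightarrow> ('o, 'a, 'p, 'b) cat_map \<Rightarrow> ('o, 'a, 'q, 'c) cat_map" where
  "functor_comp G F = \<lparr>FObj = \<lambda>a. FObj G (FObj F a), FArr = \<lambda>f. FArr G (FArr F f)\<rparr>"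

definition filtered :: "('o, 'a) category \<Rightarrow> bool" where
  "filtered J \<longleftrightarrow>
     Obj J \<noteq> {} \<and>
     (\<forall>i\<in>Obj J. \<forall>j\<in>Obj J. \<exists>k\<in>Obj J. Hom J i k \<noteq> {} \<and> Hom J j k \<noteq> {}) \<and>
     (\<forall>i\<in>Obj J. \<forall>j\<in>Obj J. \<forall>u\<in>Hom J i j. \<forall>v\<in>Hom J i j.
        \<exists>k\<in>Obj J. \<exists>w\<in>Hom J j k. Comp J w u = Comp J w v)"

definition is_cocone ::
    "('j, 'k) category \<Rightarrow> ('o, 'a) category \<Rightarrow> ('j, 'k, 'o, 'a) cat_map \<Rightarrow> 'o \<Rightarrow> ('j \<Rightarrow> 'a) \<Rightarrow> bool"
  where
  "is_cocone J C D c l \<longleftrightarrow>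
     c \<in> Obj C \<and>
     (\<forall>j\<in>Obj J. l j \<in> Hom C (FObj D j) c) \<and>
     (\<forall>u\<in>Arr J. Comp C (l (Cod J u)) (FArr D u) = l (Dom J u))"

definition is_colimit ::
    "('j, 'k) category \<Rightarrow> ('o, 'a) category \<Rightarrow> ('j, 'k, 'o, 'a) cat_map \<Rightarrow> 'o \<Rightarrow> ('j \<Rightarrow> 'a) \<Rightarrow> bool"
  where
  "is_colimit J C D c l \<longleftrightarrow>
     is_cocone J C D c l \<and>
     (\<forall>c' l'. is_cocone J C D c' l' \<longrightarrow>
        (\<exists>!h. h \<in> Hom C c c' \<and> (\<forall>j\<in>Obj J. Comp C h (l j) = l' j)))"

text \<open>
  A type \<open>'u\<close> plays the role of the universe: the small sets are the sets of elements of \<open>'u\<close>,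
  and a small category is one whose objects and arrows are elements of \<open>'u\<close>.  For infinite
  \<open>'u\<close> the categories of small sets and of small \<open>M\<close>-sets below have all small filtered colimits.
\<close>

definition preserves_filtered_colimits ::
    "'u itself \<Rightarrow> ('o, 'a) category \<Rightarrow> ('p, 'b) category \<Rightarrow> ('o, 'a, 'p, 'b) cat_map \<Rightarrow> bool" where
  "preserves_filtered_colimits (U :: 'u itself) C E F \<longleftrightarrow>
     (\<forall>(J :: ('u, 'u) category) D c l.
        is_category J \<and> filtered J \<and> is_functor J C D \<and> is_colimit J C D c l \<longrightarrow>
        is_colimit J E (functor_comp F D) (FObj F c) (\<lambda>j. FArr F (l j)))"


section \<open>Sets and hom-functors\<close>

datatype ('o, 'x) map_arrow = Arrow (source: 'o) (target: 'o) (fn: "'x \<Rightarrow> 'x")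

definition set_category :: "('x set, ('x set, 'x) map_arrow) category" where
  "set_category =
     \<lparr>Obj = UNIV,
      Arr = {Arrow A B f | A B f. f \<in> A \<rightarrow>\<^sub>E B},
      Dom = source, Cod = target,
      Id = \<lambda>A. Arrow A A (\<lambda>x\<in>A. x),
      Comp = \<lambda>g f. Arrow (source f) (target g) (compose (source f) (fn g) (fn f))\<rparr>"

text \<open>The sets in the image of \<open>Hom(b,-)\<close> are sets of arrows, hence the instance of
  \<^const>\<open>set_category\<close> at the type of arrows.\<close>

definition hom_functor ::
    "('o, 'a) category \<Rightarrow> 'o \<Rightarrow> ('o, 'a, 'a set, ('a set, 'a) map_arrow) cat_map" where
  "hom_functor C b =
     \<lparr>FObj = \<lambda>c. Hom C b c,
      FArr = \<lambda>h. Arrow (Hom C b (Dom C h)) (Hom C b (Cod C h)) (\<lambda>g\<in>Hom C b (Dom C h). Comp C h g)\<rparr>"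

definition finitely_presentable :: "'u itself \<Rightarrow> ('o, 'a) category \<Rightarrow> 'o \<Rightarrow> bool" where
  "finitely_presentable U C b \<longleftrightarrow>
     b \<in> Obj C \<and> preserves_filtered_colimits U C set_category (hom_functor C b)"


section \<open>Right \<open>M\<close>-sets\<close>

record ('x, 'm) right_mset =
  points :: "'x set"
  act :: "'x \<times> 'm \<Rightarrow> 'x"

definition is_right_mset :: "('m, 'r) monoid_scheme \<Rightarrow> ('x, 'm) right_mset \<Rightarrow> bool" where
  "is_right_mset M X \<longleftrightarrow>
     act X \<in> points X \<times> carrier M \<rightarrow>\<^sub>E points X \<and>
     (\<forall>x\<in>points X. act X (x, \<one>\<^bsub>M\<^esub>) = x) \<and>
     (\<forall>x\<in>points X. \<forall>m\<in>carrier M. \<forall>n\<in>carrier M.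
        act X (act X (x, m), n) = act X (x, m \<otimes>\<^bsub>M\<^esub> n))"

definition equivariant_maps ::
    "('m, 'r) monoid_scheme \<Rightarrow> ('x, 'm) right_mset \<Rightarrow> ('x, 'm) right_mset \<Rightarrow> ('x \<Rightarrow> 'x) set" where
  "equivariant_maps M X Y =
     {f \<in> points X \<rightarrow>\<^sub>E points Y.
        \<forall>x\<in>points X. \<forall>m\<in>carrier M. f (act X (x, m)) = act Y (f x, m)}"

definition PSh ::
    "'u itself \<Rightarrow> ('m, 'r) monoid_scheme \<Rightarrow>
     (('u, 'm) right_mset, (('u, 'm) right_mset, 'u) map_arrow) category" where
  "PSh U M =
     \<lparr>Obj = {X. is_right_mset M X},
      Arr = {Arrow X Y f | X Y f.
               is_right_mset M X \<and> is_right_mset M Y \<and> f \<in> equivariant_maps M X Y},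
      Dom = source, Cod = target,
      Id = \<lambda>X. Arrow X X (\<lambda>x\<in>points X. x),
      Comp = \<lambda>g f. Arrow (source f) (target g) (compose (points (source f)) (fn g) (fn f))\<rparr>"

definition fixed_points :: "('m, 'r) monoid_scheme \<Rightarrow> ('x, 'm) right_mset \<Rightarrow> 'x set" where
  "fixed_points M X = {x \<in> points X. \<forall>m\<in>carrier M. act X (x, m) = x}"

definition global_sections ::
    "'u itself \<Rightarrow> ('m, 'r) monoid_scheme \<Rightarrow>
     (('u, 'm) right_mset, (('u, 'm) right_mset, 'u) map_arrow,
      'u set, ('u set, 'u) map_arrow) cat_map" where
  "global_sections U M =
     \<lparr>FObj = fixed_points M,
      FArr = \<lambda>h. Arrow (fixed_points M (source h)) (fixed_points M (target h))
                      (restrict (fn h) (fixed_points M (source h)))\<rparr>"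

text \<open>The single point of the one-element \<open>M\<close>-set is the arbitrary element \<^const>\<open>undefined\<close>.\<close>

definition terminal_mset :: "'u itself \<Rightarrow> ('m, 'r) monoid_scheme \<Rightarrow> ('u, 'm) right_mset" where
  "terminal_mset U M =
     \<lparr>points = {undefined}, act = (\<lambda>_\<in>{undefined} \<times> carrier M. undefined)\<rparr>"


section \<open>Right-factorable submonoids\<close>

definition right_factorable :: "('m, 'r) monoid_scheme \<Rightarrow> 'm set \<Rightarrow> bool" where
  "right_factorable M T \<longleftrightarrow>
     T \<subseteq> carrier M \<and> (\<forall>x\<in>T. \<forall>y\<in>carrier M. x \<otimes>\<^bsub>M\<^esub> y \<in> T \<longrightarrow> y \<in> T)"

definition rf_generated :: "('m, 'r) monoid_scheme \<Rightarrow> 'm set \<Rightarrow> 'm set" where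
  "rf_generated M S = \<Inter>{T. submonoid T M \<and> right_factorable M T \<and> S \<subseteq> T}"

definition right_factorably_finitely_generated :: "('m, 'r) monoid_scheme \<Rightarrow> bool" where
  "right_factorably_finitely_generated M \<longleftrightarrow>
     (\<exists>S. S \<subseteq> carrier M \<and> finite S \<and> S \<noteq> {} \<and> rf_generated M S = carrier M)"


section \<open>Well-definedness\<close>

lemma rf_generated_least:
  fixes M (structure)
  assumes "monoid M" and S: "S \<subseteq> carrier M"
  shows "submonoid (rf_generated M S) M" "right_factorable M (rf_generated M S)"
    "S \<subseteq> rf_generated M S"
    "\<And>T. submonoid T M \<Longrightarrow> right_factorable M T \<Longrightarrow> S \<subseteq> T \<Longrightarrow> rf_generated M S \<subseteq> T"
proof -
  interpret monoid M by fact
  have top: "submonoid (carrier M) M" "right_factorable M (carrier M)"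
    by (auto simp: right_factorable_def intro!: submonoid.intro)
  have sub: "rf_generated M S \<subseteq> carrier M"
    using top S by (auto simp: rf_generated_def)
  show "submonoid (rf_generated M S) M"
    by (rule submonoid.intro[OF sub])
      (simp_all add: rf_generated_def submonoid.m_closed submonoid.one_closed)
  show "right_factorable M (rf_generated M S)"
    using sub unfolding right_factorable_def rf_generated_def by blast
qed (auto simp: rf_generated_def)

lemma mem_Arr_set_category:
  "h \<in> Arr set_category \<longleftrightarrow> fn h \<in> source h \<rightarrow>\<^sub>E target h"
  by (cases h) (auto simp: set_category_def)

lemma set_category_sel:
  "Obj set_category = UNIV" "Dom set_category = source" "Cod set_category = target"
  "Id set_category A = Arrow A A (\<lambda>x\<in>A. x)"
  "Comp set_category g f = Arrow (source f) (target g) (compose (source f) (fn g) (fn f))"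
  by (simp_all add: set_category_def)

lemma mem_Arr_PSh:
  "h \<in> Arr (PSh U M) \<longleftrightarrow>
     is_right_mset M (source h) \<and> is_right_mset M (target h) \<and>
     fn h \<in> equivariant_maps M (source h) (target h)"
  by (cases h) (auto simp: PSh_def)

lemma PSh_sel:
  "Obj (PSh U M) = {X. is_right_mset M X}" "Dom (PSh U M) = source" "Cod (PSh U M) = target"
  "Id (PSh U M) X = Arrow X X (\<lambda>x\<in>points X. x)"
  "Comp (PSh U M) g f =
     Arrow (source f) (target g) (compose (points (source f)) (fn g) (fn f))"
  by (simp_all add: PSh_def)

lemma compose_restrict_id:
  assumes "f \<in> A \<rightarrow>\<^sub>E B"
  shows "compose A f (\<lambda>x\<in>A. x) = f" "compose A (\<lambda>x\<in>B. x) f = f"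
  using assms by (auto simp: compose_def PiE_iff intro!: extensionalityI[where A = A])

lemma compose_compose:
  assumes "f \<in> A \<rightarrow>\<^sub>E B"
  shows "compose A h (compose A g f) = compose A (compose B h g) f"
  using assms by (auto simp: compose_def PiE_iff intro!: extensionalityI[where A = A])

lemma compose_PiE:
  assumes "f \<in> A \<rightarrow>\<^sub>E B" "g \<in> B \<rightarrow>\<^sub>E C"
  shows "compose A g f \<in> A \<rightarrow>\<^sub>E C"
  using assms by (auto simp: compose_def PiE_iff)

lemma is_category_set_category: "is_category set_category"
  unfolding is_category_def Hom_def set_category_sel
  by (simp add: mem_Arr_set_category compose_restrict_id compose_compose map_arrow.expand Ball_def)
    (metis compose_PiE)

lemma equivariant_maps_PiE: "f \<in> equivariant_maps M X Y \<Longrightarrow> f \<in> points X \<rightarrow>\<^sub>E points Y"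
  by (simp add: equivariant_maps_def)

lemma act_closed:
  "is_right_mset M X \<Longrightarrow> x \<in> points X \<Longrightarrow> m \<in> carrier M \<Longrightarrow> act X (x, m) \<in> points X"
  by (auto simp: is_right_mset_def)

lemma compose_equivariant:
  assumes "is_right_mset M X" "f \<in> equivariant_maps M X Y" "g \<in> equivariant_maps M Y Z"
  shows "compose (points X) g f \<in> equivariant_maps M X Z"
proof -
  have "compose (points X) g f \<in> points X \<rightarrow>\<^sub>E points Z"
    by (rule compose_PiE[OF assms(2,3)[THEN equivariant_maps_PiE]])
  moreover have "f x \<in> points Y" if "x \<in> points X" for x
    using equivariant_maps_PiE[OF assms(2)] that by blast
  ultimately show ?thesis
    using assms by (simp add: equivariant_maps_def compose_def act_closed)
qed

lemma id_equivariant: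
  "is_right_mset M X \<Longrightarrow> (\<lambda>x\<in>points X. x) \<in> equivariant_maps M X X"
  by (simp add: equivariant_maps_def act_closed)

lemma is_category_PSh: "is_category (PSh U M)"
  unfolding is_category_def Hom_def mem_Arr_PSh PSh_sel
  by (auto simp: mem_Arr_PSh compose_restrict_id[OF equivariant_maps_PiE]
      compose_compose[OF equivariant_maps_PiE] map_arrow.expand
      intro: compose_equivariant id_equivariant)

lemma is_functor_hom_functor:
  assumes C: "is_category C" and b: "b \<in> Obj C"
  shows "is_functor C set_category (hom_functor C b)"
proof -
  have comp: "Comp C h g \<in> Hom C b (Cod C h)" if "h \<in> Arr C" "g \<in> Hom C b (Dom C h)" for h g
    using C that by (simp add: is_category_def Hom_def)
  have idl: "Comp C (Id C a) g = g" if "g \<in> Hom C b a" for a g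
    using C that by (auto simp: is_category_def Hom_def)
  have id: "Dom C (Id C a) = a" "Cod C (Id C a) = a" if "a \<in> Obj C" for a
    using C that by (simp_all add: is_category_def Hom_def)
  have comp_dc: "Dom C (Comp C g f) = Dom C f" "Cod C (Comp C g f) = Cod C g"
    if "f \<in> Arr C" "g \<in> Arr C" "Cod C f = Dom C g" for f g
    using C that by (simp_all add: is_category_def Hom_def)
  have assoc: "Comp C (Comp C g f) k = Comp C g (Comp C f k)"
    if "f \<in> Arr C" "g \<in> Arr C" "Cod C f = Dom C g" "k \<in> Hom C b (Dom C f)" for f g k
    using C that by (simp add: is_category_def Hom_def)
  have mem: "FArr (hom_functor C b) f
      \<in> Hom set_category (FObj (hom_functor C b) (Dom C f)) (FObj (hom_functor C b) (Cod C f))"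
    if "f \<in> Arr C" for f
    using comp[OF that]
    by (simp add: Hom_def[of set_category] mem_Arr_set_category set_category_sel hom_functor_def)
  have ids: "FArr (hom_functor C b) (Id C a) = Id set_category (FObj (hom_functor C b) a)"
    if "a \<in> Obj C" for a
    using idl by (simp add: hom_functor_def set_category_sel id that cong: restrict_cong)
  have comps: "FArr (hom_functor C b) (Comp C g f)
      = Comp set_category (FArr (hom_functor C b) g) (FArr (hom_functor C b) f)"
    if "f \<in> Arr C" "g \<in> Arr C" "Cod C f = Dom C g" for f g
    using comp[OF that(1)] assoc[OF that] that(3)
    by (simp add: hom_functor_def set_category_sel comp_dc[OF that] compose_def
        cong: restrict_cong)
  show ?thesis
    unfolding is_functor_def using mem ids comps by (simp add: set_category_sel)
qed

lemma fixed_points_subset: "x \<in> fixed_points M X \<Longrightarrow> x \<in> points X"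
  by (simp add: fixed_points_def)

lemma equivariant_fixed_points:
  assumes "f \<in> equivariant_maps M X Y" "x \<in> fixed_points M X"
  shows "f x \<in> fixed_points M Y"
proof -
  have x: "x \<in> points X" "\<And>m. m \<in> carrier M \<Longrightarrow> act X (x, m) = x"
    using assms(2) by (simp_all add: fixed_points_def)
  have f: "f x \<in> points Y"
    using equivariant_maps_PiE[OF assms(1)] x(1) by blast
  have "act Y (f x, m) = f x" if "m \<in> carrier M" for m
  proof -
    have "act Y (f x, m) = f (act X (x, m))"
      using assms(1) x(1) that by (simp add: equivariant_maps_def)
    then show ?thesis using x(2)[OF that] by simp
  qed
  with f show ?thesis by (simp add: fixed_points_def)
qed

lemma is_functor_global_sections: "is_functor (PSh U M) set_category (global_sections U M)"
proof -
  let ?G = "global_sections U M"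
  have mem: "FArr ?G f \<in> Hom set_category (FObj ?G (source f)) (FObj ?G (target f))"
    if "f \<in> Arr (PSh U M)" for f
    using that equivariant_fixed_points
    by (auto simp: Hom_def mem_Arr_set_category mem_Arr_PSh set_category_sel global_sections_def)
  have ids: "FArr ?G (Id (PSh U M) X) = Id set_category (FObj ?G X)" for X
    by (simp add: global_sections_def PSh_sel set_category_sel fixed_points_subset
        cong: restrict_cong)
  have comps: "FArr ?G (Comp (PSh U M) g f) = Comp set_category (FArr ?G g) (FArr ?G f)"
    if "f \<in> Arr (PSh U M)" "g \<in> Arr (PSh U M)" "target f = source g" for f g
    using that equivariant_fixed_points[of "fn f" M "source f" "source g"]
    by (simp add: global_sections_def PSh_sel set_category_sel mem_Arr_PSh compose_def
        fixed_points_subset cong: restrict_cong)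
  show ?thesis
    unfolding is_functor_def using mem ids comps by (simp add: set_category_sel PSh_sel)
qed

lemma terminal_mset_terminal:
  assumes "monoid M"
  shows "terminal_mset U M \<in> Obj (PSh U M)"
    and "X \<in> Obj (PSh U M) \<Longrightarrow> \<exists>!h. h \<in> Hom (PSh U M) X (terminal_mset U M)"
proof -
  interpret monoid M by fact
  show T: "terminal_mset U M \<in> Obj (PSh U M)"
    by (auto simp: PSh_def is_right_mset_def terminal_mset_def)
  assume X: "X \<in> Obj (PSh U M)"
  show "\<exists>!h. h \<in> Hom (PSh U M) X (terminal_mset U M)"
  proof
    show "Arrow X (terminal_mset U M) (\<lambda>x\<in>points X. undefined) \<in> Hom (PSh U M) X (terminal_mset U M)"
      using T X
      by (auto simp: PSh_def Hom_def equivariant_maps_def terminal_mset_def is_right_mset_def)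
  next
    fix h assume "h \<in> Hom (PSh U M) X (terminal_mset U M)"
    then show "h = Arrow X (terminal_mset U M) (\<lambda>x\<in>points X. undefined)"
      by (auto simp: PSh_def Hom_def equivariant_maps_def terminal_mset_def PiE_iff
          intro!: extensionalityI[where A = "points X"])
  qed
qed

end

theory Submission
  imports Defs "HOL-Algebra.Free_Abelian_Groups"
begin

text \<open>
  A filtered colimit of \<open>M\<close>-sets is computed on underlying sets, so a point of the colimit comes
  from some stage and finitely many equations between points already hold at a later stage.  Let
  \<open>z\<close> be a fixed point of the colimit and \<open>M = \<langle>S\<rangle>\<rangle>\<close> with \<open>S\<close> finite: some
  representative of \<open>z\<close> is fixed by \<open>S\<close>, and since the stabiliser of a point is a
  right-factorable submonoid it is fixed by \<open>M\<close>.  So fixed points, and likewise maps out of \<open>1\<close>,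
  commute with filtered colimits.

  Conversely, \<open>1\<close> is the filtered colimit over finite \<open>F \<subseteq> M\<close> of quotients of \<open>M\<close> by right
  congruences that identify the elements of \<open>F\<close> with \<open>1\<close> and for which every right-factorable
  submonoid containing \<open>F\<close> is saturated.  If fixed points lift, then some such quotient has a
  fixed point \<open>[m]\<close>, and for every \<open>n\<close> the relation \<open>[mn] = [m]\<close> forces \<open>n\<close> into the
  right-factorable submonoid generated by \<open>F\<close> and \<open>m\<close>.
\<close>

section \<open>Filtered colimits of sets\<close>

lemma HomD: "f \<in> Hom C a b \<Longrightarrow> f \<in> Arr C \<and> Dom C f = a \<and> Cod C f = b"
  by (simp add: Hom_def)

lemma Comp_Hom:
  "is_category C \<Longrightarrow> f \<in> Hom C a b \<Longrightarrow> g \<in> Hom C b c \<Longrightarrow> Comp C g f \<in> Hom C a c"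
  by (simp add: is_category_def Hom_def)

lemma Id_Hom: "is_category C \<Longrightarrow> a \<in> Obj C \<Longrightarrow> Id C a \<in> Hom C a a"
  by (simp add: is_category_def)

lemma Hom_Obj: "is_category C \<Longrightarrow> f \<in> Hom C a b \<Longrightarrow> a \<in> Obj C \<and> b \<in> Obj C"
  by (auto simp: is_category_def Hom_def)

section \<open>Filtered diagrams of sets and germs\<close>

text \<open>A diagram reduced to its sets \<open>P\<close> and transition maps \<open>T\<close>, so
  that diagrams in \<open>set_category\<close> and the underlying diagrams of those in
  \<open>PSh\<close> share one elementwise theory.\<close>

locale filtered_sets =
  fixes J :: "('j, 'k) category" and P :: "'j \<Rightarrow> 'x set" and T :: "'k \<Rightarrow> 'x \<Rightarrow> 'x"
  assumes cat: "is_category J"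
    and filt: "filtered J"
    and T_closed: "u \<in> Hom J i j \<Longrightarrow> x \<in> P i \<Longrightarrow> T u x \<in> P j"
    and T_comp: "u \<in> Hom J i j \<Longrightarrow> v \<in> Hom J j k \<Longrightarrow> x \<in> P i \<Longrightarrow>
      T (Comp J v u) x = T v (T u x)"
begin

lemma upper_bound:
  assumes "i \<in> Obj J" "j \<in> Obj J"
  obtains k u v where "u \<in> Hom J i k" "v \<in> Hom J j k"
  using filt assms unfolding filtered_def by blast

lemma coequalizer:
  assumes "u \<in> Hom J i j" "v \<in> Hom J i j"
  obtains k w where "w \<in> Hom J j k" "Comp J w u = Comp J w v"
  using filt assms Hom_Obj[OF cat assms(1)] unfolding filtered_def by blast

lemma T_coequalizer:
  assumes "u \<in> Hom J i j" "v \<in> Hom J i j"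
  obtains k w where "w \<in> Hom J j k" "\<And>x. x \<in> P i \<Longrightarrow> T w (T u x) = T w (T v x)"
proof -
  obtain k w where w: "w \<in> Hom J j k" "Comp J w u = Comp J w v"
    using coequalizer[OF assms] .
  show thesis
    by (rule that[OF w(1)])
      (simp add: T_comp[OF assms(1) w(1), symmetric] T_comp[OF assms(2) w(1), symmetric] w(2))
qed

text \<open>The standard relation on the disjoint union of the stages whose quotient is the filtered
  colimit of sets: two elements are related if they agree at some common later stage.\<close>

definition germ_eq :: "(('j \<times> 'x) \<times> ('j \<times> 'x)) set" where
  "germ_eq = {((i, x), (j, y)). x \<in> P i \<and> y \<in> P j \<and> i \<in> Obj J \<and> j \<in> Obj J \<and>
     (\<exists>k. \<exists>u\<in>Hom J i k. \<exists>v\<in>Hom J j k. T u x = T v y)}"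

text \<open>The relation supplies two possibly different arrows out of \<open>j\<close>; composing
  both with an arrow that coequalizes them leaves a single arrow identifying the two
  elements.\<close>

lemma germ_eqE:
  assumes "((j, x), (j, y)) \<in> germ_eq"
  obtains k u where "u \<in> Hom J j k" "T u x = T u y"
proof -
  obtain k u v where uv: "u \<in> Hom J j k" "v \<in> Hom J j k" "T u x = T v y" and xy: "x \<in> P j" "y \<in> P j"
    using assms by (auto simp: germ_eq_def)
  obtain k' w where w: "w \<in> Hom J k k'" "\<And>x. x \<in> P j \<Longrightarrow> T w (T u x) = T w (T v x)"
    using T_coequalizer[OF uv(1,2)] by blast
  show thesis
  proof
    show "Comp J w u \<in> Hom J j k'" using Comp_Hom[OF cat uv(1) w(1)] .
    show "T (Comp J w u) x = T (Comp J w u) y"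
      unfolding T_comp[OF uv(1) w(1) xy(1)] T_comp[OF uv(1) w(1) xy(2)] uv(3) w(2)[OF xy(2)] ..
  qed
qed

lemma equiv_germ_eq: "equiv (Sigma (Obj J) P) germ_eq"
proof (intro equivI)
  show "germ_eq \<subseteq> Sigma (Obj J) P \<times> Sigma (Obj J) P"
    by (auto simp: germ_eq_def)
  show "refl_on (Sigma (Obj J) P) germ_eq"
  proof (rule refl_onI)
    fix a assume "a \<in> Sigma (Obj J) P"
    then show "(a, a) \<in> germ_eq" using Id_Hom[OF cat] unfolding germ_eq_def by blast
  qed
  show "sym germ_eq"
  proof (rule symI)
    fix a b assume "(a, b) \<in> germ_eq"
    then show "(b, a) \<in> germ_eq" unfolding germ_eq_def by (auto; metis)
  qed
  show "trans germ_eq"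
  proof (rule transI)
    fix a b c assume ab: "(a, b) \<in> germ_eq" and bc: "(b, c) \<in> germ_eq"
    obtain i x j y k z where abc: "a = (i, x)" "b = (j, y)" "c = (k, z)"
      by (cases a; cases b; cases c)
    obtain p u v where 1: "u \<in> Hom J i p" "v \<in> Hom J j p" "T u x = T v y"
      and x: "x \<in> P i" "i \<in> Obj J" and y: "y \<in> P j"
      using ab by (auto simp: germ_eq_def abc)
    obtain q u' v' where 2: "u' \<in> Hom J j q" "v' \<in> Hom J k q" "T u' y = T v' z"
      and z: "z \<in> P k" "k \<in> Obj J"
      using bc by (auto simp: germ_eq_def abc)
    \<comment> \<open>Both witnesses are moved to a common stage \<open>r\<close>. The two resulting
      arrows from \<open>j\<close> to \<open>r\<close> may differ, so a further \<open>w\<close> is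
      needed before \<open>y\<close> can link \<open>x\<close> to \<open>z\<close>.\<close>
    obtain r s t where 3: "s \<in> Hom J p r" "t \<in> Hom J q r"
      using upper_bound[of p q] Hom_Obj[OF cat 1(1)] Hom_Obj[OF cat 2(1)] by blast
    obtain r' w where 4: "w \<in> Hom J r r'"
        "\<And>y. y \<in> P j \<Longrightarrow> T w (T (Comp J s v) y) = T w (T (Comp J t u') y)"
      using T_coequalizer[OF Comp_Hom[OF cat 1(2) 3(1)] Comp_Hom[OF cat 2(1) 3(2)]] by blast
    note H = Comp_Hom[OF cat]
    have "T (Comp J w (Comp J s u)) x = T w (T s (T u x))"
      using T_comp[OF H[OF 1(1) 3(1)] 4(1)] T_comp[OF 1(1) 3(1)] x by simp
    also have "\<dots> = T w (T t (T u' y))"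
      using 4(2)[OF y] T_comp[OF 1(2) 3(1) y] T_comp[OF 2(1) 3(2) y] 1(3) by simp
    also have "\<dots> = T (Comp J w (Comp J t v')) z"
      using T_comp[OF H[OF 2(2) 3(2)] 4(1)] T_comp[OF 2(2) 3(2)] 2(3) z by simp
    finally show "(a, c) \<in> germ_eq"
      using H[OF H[OF 1(1) 3(1)] 4(1)] H[OF H[OF 2(2) 3(2)] 4(1)] x z
      by (auto simp: germ_eq_def abc)
  qed
qed

end

section \<open>Elementwise description of a filtered colimit\<close>

text \<open>Joint surjectivity and detection of equality at a later stage are the two elementwise
  properties that yield the universal property: the first gives uniqueness, both together give
  existence of the mediating map.\<close>

locale concrete_colimit = filtered_sets J P T
  for J :: "('j, 'k) category" and P :: "'j \<Rightarrow> 'x set" and T +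
  fixes C :: "'y set" and L :: "'j \<Rightarrow> 'x \<Rightarrow> 'y"
  assumes L_closed: "j \<in> Obj J \<Longrightarrow> x \<in> P j \<Longrightarrow> L j x \<in> C"
    and L_compat: "u \<in> Hom J i j \<Longrightarrow> x \<in> P i \<Longrightarrow> L j (T u x) = L i x"
    and L_surj: "y \<in> C \<Longrightarrow> \<exists>j\<in>Obj J. \<exists>x\<in>P j. L j x = y"
    and L_detect: "j \<in> Obj J \<Longrightarrow> x \<in> P j \<Longrightarrow> x' \<in> P j \<Longrightarrow> L j x = L j x' \<Longrightarrow>
      \<exists>k. \<exists>u\<in>Hom J j k. T u x = T u x'"
begin

text \<open>Both representatives are pushed to a common stage, where \<open>L_detect\<close>
  provides a still later stage at which they coincide; compatibility of \<open>L'\<close> carries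
  this equality back.\<close>

lemma factor_wd:
  assumes compat: "\<And>u i j x. u \<in> Hom J i j \<Longrightarrow> x \<in> P i \<Longrightarrow> L' j (T u x) = L' i x"
    and i: "i \<in> Obj J" "x \<in> P i" and j: "j \<in> Obj J" "y \<in> P j" and eq: "L i x = L j y"
  shows "L' i x = L' j y"
proof -
  obtain k u v where uv: "u \<in> Hom J i k" "v \<in> Hom J j k"
    using upper_bound[OF i(1) j(1)] .
  have "L k (T u x) = L k (T v y)"
    using L_compat[OF uv(1) i(2)] L_compat[OF uv(2) j(2)] eq by simp
  then obtain k' w where w: "w \<in> Hom J k k'" "T w (T u x) = T w (T v y)"
    using L_detect[of k "T u x" "T v y"] T_closed[OF uv(1) i(2)] T_closed[OF uv(2) j(2)]
      Hom_Obj[OF cat uv(1)] by blast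
  show ?thesis
    unfolding compat[OF uv(1) i(2), symmetric] compat[OF uv(2) j(2), symmetric]
      compat[OF w(1) T_closed[OF uv(1) i(2)], symmetric]
      compat[OF w(1) T_closed[OF uv(2) j(2)], symmetric] w(2) ..
qed

lemma factor:
  assumes closed: "\<And>j x. j \<in> Obj J \<Longrightarrow> x \<in> P j \<Longrightarrow> L' j x \<in> C'"
    and compat: "\<And>u i j x. u \<in> Hom J i j \<Longrightarrow> x \<in> P i \<Longrightarrow> L' j (T u x) = L' i x"
  obtains h where "h \<in> C \<rightarrow>\<^sub>E C'" "\<And>j x. j \<in> Obj J \<Longrightarrow> x \<in> P j \<Longrightarrow> h (L j x) = L' j x"
proof
  \<comment> \<open>The value at \<open>y\<close> is read off from an arbitrary representative;
    \<open>factor_wd\<close> shows that the choice does not matter.\<close>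
  define h where "h = (\<lambda>y\<in>C. SOME z. \<exists>j\<in>Obj J. \<exists>x\<in>P j. L j x = y \<and> L' j x = z)"
  show h: "h (L j x) = L' j x" if "j \<in> Obj J" "x \<in> P j" for j x
  proof -
    have "h (L j x) = (SOME z. \<exists>i\<in>Obj J. \<exists>x'\<in>P i. L i x' = L j x \<and> L' i x' = z)"
      using L_closed[OF that] by (simp add: h_def)
    then have "\<exists>i\<in>Obj J. \<exists>x'\<in>P i. L i x' = L j x \<and> L' i x' = h (L j x)"
      using someI_ex[of "\<lambda>z. \<exists>i\<in>Obj J. \<exists>x'\<in>P i. L i x' = L j x \<and> L' i x' = z"] that by auto
    then obtain i x' where x': "i \<in> Obj J" "x' \<in> P i" "L i x' = L j x" "L' i x' = h (L j x)"
      by blast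
    show ?thesis using factor_wd[of L', OF compat x'(1,2) that x'(3)] x'(4) by simp
  qed
  show "h \<in> C \<rightarrow>\<^sub>E C'"
  proof (rule PiE_I)
    fix y assume "y \<in> C"
    then obtain j x where x: "j \<in> Obj J" "x \<in> P j" "L j x = y" using L_surj by blast
    show "h y \<in> C'" using h[OF x(1,2)] closed[OF x(1,2)] x(3) by simp
  qed (simp add: h_def)
qed

text \<open>Uniqueness of mediating maps: the images of the \<open>L j\<close> cover
  \<open>C\<close>, and extensional functions on \<open>C\<close> are determined by their values
  there.\<close>

lemma eqI:
  assumes "h \<in> extensional C" "h' \<in> extensional C"
    and "\<And>j x. j \<in> Obj J \<Longrightarrow> x \<in> P j \<Longrightarrow> h (L j x) = h' (L j x)"
  shows "h = h'"
proof (rule extensionalityI[OF assms(1,2)])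
  fix y assume "y \<in> C"
  then obtain j x where "j \<in> Obj J" "x \<in> P j" "L j x = y" using L_surj by blast
  then show "h y = h' y" using assms(3) by blast
qed

end

section \<open>Functors, cocones and arrows in the categories of sets and of
  \<open>M\<close>-sets\<close>

lemma is_functorD:
  assumes "is_functor J C D"
  shows "i \<in> Obj J \<Longrightarrow> FObj D i \<in> Obj C"
    "u \<in> Hom J i j \<Longrightarrow> FArr D u \<in> Hom C (FObj D i) (FObj D j)"
    "i \<in> Obj J \<Longrightarrow> FArr D (Id J i) = Id C (FObj D i)"
    "u \<in> Hom J i j \<Longrightarrow> v \<in> Hom J j k \<Longrightarrow> FArr D (Comp J v u) = Comp C (FArr D v) (FArr D u)"
  using assms by (auto simp: is_functor_def dest!: HomD)

lemma is_functor_comp: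
  assumes J: "is_category J" and D: "is_functor J C D" and F: "is_functor C E F"
  shows "is_functor J E (functor_comp F D)"
proof -
  have H: "f \<in> Hom J (Dom J f) (Cod J f)" if "f \<in> Arr J" for f using that by (simp add: Hom_def)
  note D' = is_functorD[OF D] and F' = is_functorD[OF F]
  show ?thesis
    unfolding is_functor_def functor_comp_def cat_map.simps
  proof (intro conjI ballI impI)
    fix f g assume fg: "f \<in> Arr J" "g \<in> Arr J" "Cod J f = Dom J g"
    show "FArr F (FArr D (Comp J g f)) = Comp E (FArr F (FArr D g)) (FArr F (FArr D f))"
      using D'(2,4)[OF H[OF fg(1)]] D'(2)[OF H[OF fg(2)]] H[OF fg(2)] F'(4) fg(3) by metis
  next
    fix f assume f: "f \<in> Arr J"
    show "FArr F (FArr D f) \<in> Hom E (FObj F (FObj D (Dom J f))) (FObj F (FObj D (Cod J f)))"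
      using F'(2)[OF D'(2)[OF H[OF f]]] .
  qed (simp_all add: D'(1,3) F'(1,3))
qed

lemma mem_Hom_set_category:
  "h \<in> Hom set_category A B \<longleftrightarrow> source h = A \<and> target h = B \<and> fn h \<in> A \<rightarrow>\<^sub>E B"
  by (auto simp: Hom_def mem_Arr_set_category set_category_sel)

lemma mem_Hom_PSh:
  "h \<in> Hom (PSh U M) X Y \<longleftrightarrow> source h = X \<and> target h = Y \<and> is_right_mset M X \<and>
     is_right_mset M Y \<and> fn h \<in> equivariant_maps M X Y"
  by (auto simp: Hom_def mem_Arr_PSh PSh_sel)

lemma map_arrow_eq_iff: "f = g \<longleftrightarrow> source f = source g \<and> target f = target g \<and> fn f = fn g"
  by (cases f; cases g) simp

lemma fn_Comp_set_category: "x \<in> source f \<Longrightarrow> fn (Comp set_category g f) x = fn g (fn f x)"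
  by (simp add: set_category_sel compose_def)

lemma fn_Comp_PSh: "x \<in> points (source f) \<Longrightarrow> fn (Comp (PSh U M) g f) x = fn g (fn f x)"
  by (simp add: PSh_sel compose_def)

lemma equivariant_act:
  "f \<in> equivariant_maps M X Y \<Longrightarrow> x \<in> points X \<Longrightarrow> m \<in> carrier M \<Longrightarrow>
     f (act X (x, m)) = act Y (f x, m)"
  by (simp add: equivariant_maps_def)

lemma equivariant_closed: "f \<in> equivariant_maps M X Y \<Longrightarrow> x \<in> points X \<Longrightarrow> f x \<in> points Y"
  using equivariant_maps_PiE by blast

lemma set_category_arrow_eqI:
  assumes "f \<in> Hom set_category A B" "g \<in> Hom set_category A B" "\<And>x. x \<in> A \<Longrightarrow> fn f x = fn g x"
  shows "f = g"
  using assms by (auto simp: mem_Hom_set_category map_arrow_eq_iff PiE_iff intro: extensionalityI)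

lemma PSh_arrow_eqI:
  assumes "f \<in> Hom (PSh U M) A B" "g \<in> Hom (PSh U M) A B" "\<And>x. x \<in> points A \<Longrightarrow> fn f x = fn g x"
  shows "f = g"
proof -
  have "fn f \<in> points A \<rightarrow>\<^sub>E points B" "fn g \<in> points A \<rightarrow>\<^sub>E points B"
    using assms(1,2) equivariant_maps_PiE unfolding mem_Hom_PSh by blast+
  then have "fn f = fn g"
    using assms(3) by (auto simp: PiE_iff intro: extensionalityI)
  then show ?thesis using assms(1,2) by (simp add: map_arrow_eq_iff mem_Hom_PSh)
qed

lemma is_coconeD:
  assumes "is_cocone J C D c l"
  shows "c \<in> Obj C" "j \<in> Obj J \<Longrightarrow> l j \<in> Hom C (FObj D j) c"
    "u \<in> Hom J i j \<Longrightarrow> Comp C (l j) (FArr D u) = l i"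
  using assms by (auto simp: is_cocone_def dest!: HomD)

lemma is_coconeI:
  assumes "is_category J" "c \<in> Obj C" "\<And>j. j \<in> Obj J \<Longrightarrow> l j \<in> Hom C (FObj D j) c"
    "\<And>u i j. u \<in> Hom J i j \<Longrightarrow> i \<in> Obj J \<Longrightarrow> j \<in> Obj J \<Longrightarrow> Comp C (l j) (FArr D u) = l i"
  shows "is_cocone J C D c l"
  using assms by (auto simp: is_cocone_def Hom_def is_category_def)

lemma PSh_cocone_compat:
  assumes D: "is_functor J (PSh U M) D" and c: "is_cocone J (PSh U M) D c l"
    and u: "u \<in> Hom J i j" and x: "x \<in> points (FObj D i)"
  shows "fn (l j) (fn (FArr D u) x) = fn (l i) x"
  using is_coconeD(3)[OF c u] is_functorD(2)[OF D u] x fn_Comp_PSh mem_Hom_PSh by metis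

lemma set_cocone_compat:
  assumes D: "is_functor J set_category D" and c: "is_cocone J set_category D c l"
    and u: "u \<in> Hom J i j" and x: "x \<in> FObj D i"
  shows "fn (l j) (fn (FArr D u) x) = fn (l i) x"
  using is_coconeD(3)[OF c u] is_functorD(2)[OF D u] x fn_Comp_set_category mem_Hom_set_category
  by metis

lemma filtered_sets_set_category:
  assumes "is_category J" "filtered J" and D: "is_functor J set_category D"
  shows "filtered_sets J (FObj D) (\<lambda>u. fn (FArr D u))"
proof
  fix u v i j k x assume u: "u \<in> Hom J i j" and x: "x \<in> FObj D i"
  show "fn (FArr D u) x \<in> FObj D j"
    using is_functorD(2)[OF D u] x by (auto simp: mem_Hom_set_category)
  assume v: "v \<in> Hom J j k"
  show "fn (FArr D (Comp J v u)) x = fn (FArr D v) (fn (FArr D u) x)"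
    using is_functorD(2,4)[OF D u] v x fn_Comp_set_category mem_Hom_set_category by metis
qed (use assms in auto)

lemma filtered_sets_PSh:
  assumes "is_category J" "filtered J" and D: "is_functor J (PSh U M) D"
  shows "filtered_sets J (\<lambda>j. points (FObj D j)) (\<lambda>u. fn (FArr D u))"
proof
  fix u v i j k x assume u: "u \<in> Hom J i j" and x: "x \<in> points (FObj D i)"
  show "fn (FArr D u) x \<in> points (FObj D j)"
    using is_functorD(2)[OF D u] x equivariant_closed by (auto simp: mem_Hom_PSh)
  assume v: "v \<in> Hom J j k"
  show "fn (FArr D (Comp J v u)) x = fn (FArr D v) (fn (FArr D u) x)"
    using is_functorD(2,4)[OF D u] v x fn_Comp_PSh mem_Hom_PSh by metis
qed (use assms in auto)

section \<open>From elementwise colimits to universal properties, and back for sets\<close>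

lemma set_category_colimitI:
  assumes J: "is_category J" and D: "is_functor J set_category D"
    and c: "is_cocone J set_category D c l"
    and conc: "concrete_colimit J (FObj D) (\<lambda>u. fn (FArr D u)) c (\<lambda>j. fn (l j))"
  shows "is_colimit J set_category D c l"
  unfolding is_colimit_def
proof (intro conjI c allI impI)
  interpret concrete_colimit J "FObj D" "\<lambda>u. fn (FArr D u)" c "\<lambda>j. fn (l j)" by fact
  fix c' l' assume c': "is_cocone J set_category D c' l'"
  have l: "l j \<in> Hom set_category (FObj D j) c" "l' j \<in> Hom set_category (FObj D j) c'"
    if "j \<in> Obj J" for j
    using is_coconeD(2)[OF c that] is_coconeD(2)[OF c' that] .
  obtain h where h: "h \<in> c \<rightarrow>\<^sub>E c'"
      "\<And>j x. j \<in> Obj J \<Longrightarrow> x \<in> FObj D j \<Longrightarrow> h (fn (l j) x) = fn (l' j) x"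
  proof (rule factor)
    show "fn (l' j) x \<in> c'" if "j \<in> Obj J" "x \<in> FObj D j" for j x
      using l(2)[OF that(1)] that(2) by (auto simp: mem_Hom_set_category)
    show "fn (l' j) (fn (FArr D u) x) = fn (l' i) x" if "u \<in> Hom J i j" "x \<in> FObj D i" for u i j x
      using set_cocone_compat[OF D c' that] .
  qed blast
  show "\<exists>!h. h \<in> Hom set_category c c' \<and> (\<forall>j\<in>Obj J. Comp set_category h (l j) = l' j)"
  proof (rule ex1I[of _ "Arrow c c' h"], intro conjI ballI)
    show A: "Arrow c c' h \<in> Hom set_category c c'" using h by (simp add: mem_Hom_set_category)
    show "Comp set_category (Arrow c c' h) (l j) = l' j" if j: "j \<in> Obj J" for j
    proof (rule set_category_arrow_eqI)
      show "Comp set_category (Arrow c c' h) (l j) \<in> Hom set_category (FObj D j) c'"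
        using Comp_Hom[OF is_category_set_category l(1)[OF j] A] .
      show "fn (Comp set_category (Arrow c c' h) (l j)) x = fn (l' j) x" if "x \<in> FObj D j" for x
        using h(2)[OF j that] l(1)[OF j] that fn_Comp_set_category[of x "l j"]
        by (simp add: mem_Hom_set_category)
    qed (fact l(2)[OF j])
  next
    fix g assume g: "g \<in> Hom set_category c c' \<and> (\<forall>j\<in>Obj J. Comp set_category g (l j) = l' j)"
    have "fn g = h"
    proof (rule eqI)
      show "fn g (fn (l j) x) = h (fn (l j) x)" if "j \<in> Obj J" "x \<in> FObj D j" for j x
        using g h(2)[OF that] fn_Comp_set_category[of x "l j" g] l(1)[OF that(1)] that
        by (simp add: mem_Hom_set_category)
    qed (use g h in \<open>auto simp: mem_Hom_set_category PiE_iff\<close>)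
    then show "g = Arrow c c' h" using g by (simp add: map_arrow_eq_iff mem_Hom_set_category)
  qed
qed

text \<open>The mediating function comes from the underlying sets as in
  \<open>set_category_colimitI\<close>; what remains is its equivariance.\<close>

lemma PSh_colimitI:
  assumes J: "is_category J" and D: "is_functor J (PSh U M) D"
    and c: "is_cocone J (PSh U M) D c l"
    and conc: "concrete_colimit J (\<lambda>j. points (FObj D j)) (\<lambda>u. fn (FArr D u)) (points c) (\<lambda>j. fn (l j))"
  shows "is_colimit J (PSh U M) D c l"
  unfolding is_colimit_def
proof (intro conjI c allI impI)
  interpret concrete_colimit J "\<lambda>j. points (FObj D j)" "\<lambda>u. fn (FArr D u)" "points c" "\<lambda>j. fn (l j)"
    by fact
  fix c' l' assume c': "is_cocone J (PSh U M) D c' l'"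
  have l: "l j \<in> Hom (PSh U M) (FObj D j) c" "l' j \<in> Hom (PSh U M) (FObj D j) c'"
    if "j \<in> Obj J" for j
    using is_coconeD(2)[OF c that] is_coconeD(2)[OF c' that] .
  obtain h where h: "h \<in> points c \<rightarrow>\<^sub>E points c'"
      "\<And>j x. j \<in> Obj J \<Longrightarrow> x \<in> points (FObj D j) \<Longrightarrow> h (fn (l j) x) = fn (l' j) x"
  proof (rule factor)
    show "fn (l' j) x \<in> points c'" if "j \<in> Obj J" "x \<in> points (FObj D j)" for j x
      using l(2)[OF that(1)] that(2) equivariant_closed by (auto simp: mem_Hom_PSh)
    show "fn (l' j) (fn (FArr D u) x) = fn (l' i) x"
      if "u \<in> Hom J i j" "x \<in> points (FObj D i)" for u i j x
      using PSh_cocone_compat[OF D c' that] .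
  qed blast
  \<comment> \<open>Choosing a representative \<open>x\<close> of \<open>y\<close> at a stage
    \<open>j\<close> reduces equivariance of \<open>h\<close> to that of \<open>l j\<close> and
    \<open>l' j\<close>.\<close>
  have "h (act c (y, m)) = act c' (h y, m)" if y: "y \<in> points c" and m: "m \<in> carrier M" for y m
  proof -
    obtain j x where x: "j \<in> Obj J" "x \<in> points (FObj D j)" "fn (l j) x = y"
      using L_surj[OF y] by blast
    have e: "fn (l j) \<in> equivariant_maps M (FObj D j) c" "is_right_mset M (FObj D j)"
      "fn (l' j) \<in> equivariant_maps M (FObj D j) c'"
      using l[OF x(1)] by (auto simp: mem_Hom_PSh)
    show ?thesis
      using equivariant_act[OF e(1) x(2) m] equivariant_act[OF e(3) x(2) m] x
        h(2)[OF x(1) act_closed[OF e(2) x(2) m]] h(2)[OF x(1,2)] by metis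
  qed
  then have h_equiv: "h \<in> equivariant_maps M c c'" using h(1) by (simp add: equivariant_maps_def)
  show "\<exists>!h. h \<in> Hom (PSh U M) c c' \<and> (\<forall>j\<in>Obj J. Comp (PSh U M) h (l j) = l' j)"
  proof (rule ex1I[of _ "Arrow c c' h"], intro conjI ballI)
    show A: "Arrow c c' h \<in> Hom (PSh U M) c c'"
      using h_equiv is_coconeD(1)[OF c] is_coconeD(1)[OF c'] by (simp add: mem_Hom_PSh PSh_sel)
    show "Comp (PSh U M) (Arrow c c' h) (l j) = l' j" if j: "j \<in> Obj J" for j
    proof (rule PSh_arrow_eqI)
      show "Comp (PSh U M) (Arrow c c' h) (l j) \<in> Hom (PSh U M) (FObj D j) c'"
        using Comp_Hom[OF is_category_PSh l(1)[OF j] A] .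
      show "fn (Comp (PSh U M) (Arrow c c' h) (l j)) x = fn (l' j) x" if "x \<in> points (FObj D j)" for x
        using h(2)[OF j that] l(1)[OF j] that fn_Comp_PSh[of x "l j" U M "Arrow c c' h"] by (simp add: mem_Hom_PSh)
    qed (fact l(2)[OF j])
  next
    fix g assume g: "g \<in> Hom (PSh U M) c c' \<and> (\<forall>j\<in>Obj J. Comp (PSh U M) g (l j) = l' j)"
    have "fn g = h"
    proof (rule eqI)
      show "fn g (fn (l j) x) = h (fn (l j) x)" if "j \<in> Obj J" "x \<in> points (FObj D j)" for j x
        using g h(2)[OF that] fn_Comp_PSh[of x "l j" U M g] l(1)[OF that(1)] that
        by (simp add: mem_Hom_PSh)
    qed (use g h in \<open>auto simp: mem_Hom_PSh PiE_iff dest!: equivariant_maps_PiE\<close>)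
    then show "g = Arrow c c' h" using g by (simp add: map_arrow_eq_iff mem_Hom_PSh)
  qed
qed


lemma functor_cocone:
  assumes J: "is_category J" and D: "is_functor J C D" and F: "is_functor C E F"
    and c: "is_cocone J C D c l"
  shows "is_cocone J E (functor_comp F D) (FObj F c) (\<lambda>j. FArr F (l j))"
proof (rule is_coconeI[OF J])
  show "FObj F c \<in> Obj E"
    using is_functorD(1)[OF F is_coconeD(1)[OF c]] .
  show "FArr F (l j) \<in> Hom E (FObj (functor_comp F D) j) (FObj F c)" if "j \<in> Obj J" for j
    using is_functorD(2)[OF F is_coconeD(2)[OF c that]] by (simp add: functor_comp_def)
  show "Comp E (FArr F (l j)) (FArr (functor_comp F D) u) = FArr F (l i)"
    if "u \<in> Hom J i j" "i \<in> Obj J" "j \<in> Obj J" for u i j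
    using is_functorD(4)[OF F is_functorD(2)[OF D that(1)] is_coconeD(2)[OF c that(3)]]
      is_coconeD(3)[OF c that(1)] by (simp add: functor_comp_def)
qed

text \<open>A cocone already supplies the closure and compatibility conditions of
  \<open>concrete_colimit\<close>, so only surjectivity and detection have to be checked.\<close>

lemma set_category_colimitI2:
  assumes J: "is_category J" "filtered J" and D: "is_functor J set_category D"
    and c: "is_cocone J set_category D c l"
    and surj: "\<And>y. y \<in> c \<Longrightarrow> \<exists>j\<in>Obj J. \<exists>x\<in>FObj D j. fn (l j) x = y"
    and detect: "\<And>j x y. j \<in> Obj J \<Longrightarrow> x \<in> FObj D j \<Longrightarrow> y \<in> FObj D j \<Longrightarrow> fn (l j) x = fn (l j) y \<Longrightarrow>
      \<exists>k. \<exists>u\<in>Hom J j k. fn (FArr D u) x = fn (FArr D u) y"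
  shows "is_colimit J set_category D c l"
proof (rule set_category_colimitI[OF J(1) D c])
  interpret filtered_sets J "FObj D" "\<lambda>u. fn (FArr D u)"
    by (rule filtered_sets_set_category[OF J D])
  show "concrete_colimit J (FObj D) (\<lambda>u. fn (FArr D u)) c (\<lambda>j. fn (l j))"
  proof
    show "fn (l j) x \<in> c" if "j \<in> Obj J" "x \<in> FObj D j" for j x
      using is_coconeD(2)[OF c that(1)] that(2) by (auto simp: mem_Hom_set_category)
    show "fn (l j) (fn (FArr D u) x) = fn (l i) x" if "u \<in> Hom J i j" "x \<in> FObj D i" for u i j x
      using set_cocone_compat[OF D c that] .
  qed (fact surj detect)+
qed

text \<open>The union \<open>I\<close> of the images is itself the apex of a cocone. The mediating
  map from \<open>c\<close> to \<open>I\<close>, followed by the inclusion, is compatible with the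
  cocone \<open>l\<close>, hence is the identity by uniqueness, so \<open>I\<close> is all of
  \<open>c\<close>.\<close>

lemma set_category_colimit_surj:
  assumes J: "is_category J" and D: "is_functor J set_category D"
    and col: "is_colimit J set_category D c l" and y: "y \<in> c"
  shows "\<exists>j\<in>Obj J. \<exists>x\<in>FObj D j. fn (l j) x = y"
proof -
  have c: "is_cocone J set_category D c l" using col by (simp add: is_colimit_def)
  define I where "I = (\<Union>j\<in>Obj J. fn (l j) ` FObj D j)"
  define l' where "l' j = Arrow (FObj D j) I (fn (l j))" for j
  have l: "source (l j) = FObj D j" "target (l j) = c" "fn (l j) \<in> FObj D j \<rightarrow>\<^sub>E c"
    if "j \<in> Obj J" for j
    using is_coconeD(2)[OF c that] by (simp_all add: mem_Hom_set_category)
  have l': "l' j \<in> Hom set_category (FObj D j) I" if "j \<in> Obj J" for j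
    using l[OF that] that by (auto simp: l'_def I_def mem_Hom_set_category PiE_iff)
  have I: "I \<subseteq> c" using l by (force simp: I_def)
  have "is_cocone J set_category D I l'"
  proof (rule is_coconeI[OF J _ l'])
    fix u i j assume u: "u \<in> Hom J i j" "i \<in> Obj J" "j \<in> Obj J"
    show "Comp set_category (l' j) (FArr D u) = l' i"
      using is_coconeD(3)[OF c u(1)] is_functorD(2)[OF D u(1)] l u(2,3)
      by (auto simp: l'_def set_category_sel map_arrow_eq_iff mem_Hom_set_category)
  qed (simp_all add: set_category_sel)
  then obtain h where h: "h \<in> Hom set_category c I" "\<And>j. j \<in> Obj J \<Longrightarrow> Comp set_category h (l j) = l' j"
    using col unfolding is_colimit_def by blast
  \<comment> \<open>The target is stored in an arrow, so composing with the inclusion of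
    \<open>I\<close> keeps the function and only replaces the target.\<close>
  define h' where "h' = Arrow c c (fn h)"
  have "h' \<in> Hom set_category c c"
    using h(1) I by (auto simp: h'_def mem_Hom_set_category PiE_iff)
  moreover have "Comp set_category h' (l j) = l j" if "j \<in> Obj J" for j
    using h(2)[OF that] l[OF that]
    by (simp add: set_category_sel map_arrow_eq_iff h'_def l'_def)
  moreover have "Id set_category c \<in> Hom set_category c c"
    by (simp add: set_category_sel mem_Hom_set_category)
  moreover have "Comp set_category (Id set_category c) (l j) = l j" if "j \<in> Obj J" for j
    using l[OF that] compose_restrict_id(2)[OF l(3)[OF that]]
    by (simp add: set_category_sel map_arrow_eq_iff)
  ultimately have "h' = Id set_category c"
    using col c unfolding is_colimit_def by blast
  then have "fn h y = y"
    using y by (simp add: h'_def set_category_sel map_arrow_eq_iff)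
  moreover have "fn h y \<in> I"
    using PiE_mem[of "fn h" c "\<lambda>_. I"] h(1) y by (simp add: mem_Hom_set_category)
  ultimately have "y \<in> I" by simp
  then show ?thesis by (auto simp: I_def)
qed

section \<open>Quotients of \<open>M\<close>-sets and filtered colimits in the presheaf topos\<close>

text \<open>Points of objects of \<open>PSh\<close> must be elements of \<open>'u\<close>, so the
  quotient is transported along an injection of \<open>Y // R\<close> into \<open>'u\<close>;
  \<open>q\<close> is the resulting projection.\<close>

lemma ex_quotient_mset:
  fixes M :: "('m, 'r) monoid_scheme" and Y :: "'y set" and \<alpha> :: "'y \<Rightarrow> 'm \<Rightarrow> 'y"
  assumes "monoid M" and R: "equiv Y R" and small: "Y \<lesssim> (UNIV :: 'u set)"
    and closed: "\<And>y m. y \<in> Y \<Longrightarrow> m \<in> carrier M \<Longrightarrow> \<alpha> y m \<in> Y"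
    and one: "\<And>y. y \<in> Y \<Longrightarrow> \<alpha> y \<one>\<^bsub>M\<^esub> = y"
    and mult: "\<And>y m n. y \<in> Y \<Longrightarrow> m \<in> carrier M \<Longrightarrow> n \<in> carrier M \<Longrightarrow>
      \<alpha> (\<alpha> y m) n = \<alpha> y (m \<otimes>\<^bsub>M\<^esub> n)"
    and cong: "\<And>y z m. (y, z) \<in> R \<Longrightarrow> m \<in> carrier M \<Longrightarrow> (\<alpha> y m, \<alpha> z m) \<in> R"
  obtains q :: "'y \<Rightarrow> 'u" and X :: "('u, 'm) right_mset" where
    "is_right_mset M X" "points X = q ` Y"
    "\<And>y z. y \<in> Y \<Longrightarrow> z \<in> Y \<Longrightarrow> q y = q z \<longleftrightarrow> (y, z) \<in> R"
    "\<And>y m. y \<in> Y \<Longrightarrow> m \<in> carrier M \<Longrightarrow> act X (q y, m) = q (\<alpha> y m)"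
proof -
  interpret monoid M by fact
  have "Y // R = (\<lambda>y. R `` {y}) ` Y" by (auto simp: quotient_def)
  then have "Y // R \<lesssim> (UNIV :: 'u set)"
    using small image_lepoll lepoll_trans by metis
  then obtain \<iota> :: "'y set \<Rightarrow> 'u" where \<iota>: "inj_on \<iota> (Y // R)" by (auto simp: lepoll_def)
  define q where "q y = \<iota> (R `` {y})" for y
  have q: "q y = q z \<longleftrightarrow> (y, z) \<in> R" if "y \<in> Y" "z \<in> Y" for y z
    using inj_on_eq_iff[OF \<iota>] quotientI[OF that(1)] quotientI[OF that(2)]
      eq_equiv_class_iff[OF R that] by (simp add: q_def)
  \<comment> \<open>\<open>r\<close> chooses representatives, through which the action on the
    quotient is defined; \<open>cong\<close> makes the result independent of the choice.\<close>
  define r where "r p = (SOME y. y \<in> Y \<and> q y = p)" for p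
  have r: "r (q y) \<in> Y" "(r (q y), y) \<in> R" if "y \<in> Y" for y
    using someI[of "\<lambda>z. z \<in> Y \<and> q z = q y" y] q that by (auto simp: r_def)
  define X where
    "X = \<lparr>points = q ` Y, act = \<lambda>(p, m)\<in>q ` Y \<times> carrier M. q (\<alpha> (r p) m)\<rparr>"
  have pts: "points X = q ` Y" by (simp add: X_def)
  have act: "act X (q y, m) = q (\<alpha> y m)" if "y \<in> Y" "m \<in> carrier M" for y m
    using q[of "\<alpha> (r (q y)) m" "\<alpha> y m"] cong[OF r(2)] r(1) closed that by (simp add: X_def)
  have X: "is_right_mset M X"
    unfolding is_right_mset_def
  proof (intro conjI)
    show "act X \<in> points X \<times> carrier M \<rightarrow>\<^sub>E points X"
      using r closed by (auto simp: X_def)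
  qed (auto simp: pts act closed one mult)
  show thesis by (rule that[OF X pts q act])
qed

section \<open>Elementwise properties of an arbitrary filtered colimit of
  \<open>M\<close>-sets\<close>

text \<open>The colimit \<open>c\<close> is given only by its universal property;
  \<open>l_surj\<close> and \<open>l_detect\<close> recover from it that \<open>c\<close> is
  computed on underlying sets.\<close>

locale filtered_diagram =
  fixes U :: "'u itself" and M :: "('m, 'r) monoid_scheme" and J :: "('u, 'u) category"
    and D c l
  assumes mon: "monoid M" and inf: "infinite (UNIV :: 'u set)"
    and J: "is_category J" and filt: "filtered J"
    and D: "is_functor J (PSh U M) D"
    and col: "is_colimit J (PSh U M) D c l"
begin

lemma c: "is_cocone J (PSh U M) D c l" using col by (simp add: is_colimit_def)

lemma mset_D: "j \<in> Obj J \<Longrightarrow> is_right_mset M (FObj D j)"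
  using is_functorD(1)[OF D] by (simp add: PSh_sel)

lemma mset_c: "is_right_mset M c"
  using is_coconeD(1)[OF c] by (simp add: PSh_sel)

lemma D_arr:
  assumes "u \<in> Hom J i j"
  shows "source (FArr D u) = FObj D i" "target (FArr D u) = FObj D j"
    "fn (FArr D u) \<in> equivariant_maps M (FObj D i) (FObj D j)"
  using is_functorD(2)[OF D assms] by (simp_all add: mem_Hom_PSh)

lemma l_arr:
  assumes "j \<in> Obj J"
  shows "source (l j) = FObj D j" "target (l j) = c" "fn (l j) \<in> equivariant_maps M (FObj D j) c"
  using is_coconeD(2)[OF c assms] by (simp_all add: mem_Hom_PSh)

lemma col_unique:
  assumes "h \<in> Hom (PSh U M) c c" "\<And>j. j \<in> Obj J \<Longrightarrow> Comp (PSh U M) h (l j) = l j"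
  shows "h = Id (PSh U M) c"
proof -
  have "Comp (PSh U M) (Id (PSh U M) c) (l j) = l j" if "j \<in> Obj J" for j
    using l_arr[OF that] compose_restrict_id(2)[OF equivariant_maps_PiE, OF l_arr(3)[OF that]]
    by (simp add: PSh_sel map_arrow_eq_iff)
  moreover have "Id (PSh U M) c \<in> Hom (PSh U M) c c"
    using is_category_PSh is_coconeD(1)[OF c] by (rule Id_Hom)
  ultimately show ?thesis
    using col c assms unfolding is_colimit_def by blast
qed

text \<open>The argument of \<open>set_category_colimit_surj\<close> carries over because the union
  of the images is closed under the action: each \<open>fn (l j)\<close> is equivariant.\<close>

lemma l_surj:
  assumes y: "y \<in> points c"
  shows "\<exists>j\<in>Obj J. \<exists>x\<in>points (FObj D j). fn (l j) x = y"
proof -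
  define I where "I = (\<Union>j\<in>Obj J. fn (l j) ` points (FObj D j))"
  define X where "X = \<lparr>points = I, act = restrict (act c) (I \<times> carrier M)\<rparr>"
  have I: "I \<subseteq> points c" using equivariant_closed[OF l_arr(3)] by (auto simp: I_def)
  have act_I: "act c (y, m) \<in> I" if "y \<in> I" "m \<in> carrier M" for y m
  proof -
    obtain j x where x: "j \<in> Obj J" "x \<in> points (FObj D j)" "y = fn (l j) x"
      using \<open>y \<in> I\<close> by (auto simp: I_def)
    then have "act c (y, m) = fn (l j) (act (FObj D j) (x, m))"
      using equivariant_act[OF l_arr(3)] that by simp
    then show ?thesis
      using act_closed[OF mset_D[OF x(1)] x(2) that(2)] x(1) by (auto simp: I_def)
  qed
  have X: "is_right_mset M X"
    using mset_c I act_I monoid.m_closed[OF mon] monoid.one_closed[OF mon]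
    by (auto simp: is_right_mset_def X_def subset_iff)
  define l' where "l' j = Arrow (FObj D j) X (fn (l j))" for j
  have l': "l' j \<in> Hom (PSh U M) (FObj D j) X" if "j \<in> Obj J" for j
  proof -
    have "fn (l j) x \<in> I" if "x \<in> points (FObj D j)" for x
      using that \<open>j \<in> Obj J\<close> by (auto simp: I_def)
    then show ?thesis
      using l_arr[OF that] X mset_D[OF that]
      by (auto simp: l'_def X_def mem_Hom_PSh equivariant_maps_def PiE_iff)
  qed
  have "is_cocone J (PSh U M) D X l'"
  proof (rule is_coconeI[OF J _ l'])
    fix u i j assume u: "u \<in> Hom J i j" "i \<in> Obj J" "j \<in> Obj J"
    show "Comp (PSh U M) (l' j) (FArr D u) = l' i"
      using is_coconeD(3)[OF c u(1)] D_arr[OF u(1)] l_arr[OF u(2)]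
      by (simp add: l'_def PSh_sel map_arrow_eq_iff)
  qed (simp_all add: PSh_sel X)
  then obtain h where h: "h \<in> Hom (PSh U M) c X" "\<And>j. j \<in> Obj J \<Longrightarrow> Comp (PSh U M) h (l j) = l' j"
    using col unfolding is_colimit_def by blast
  have hI: "fn h z \<in> I" if "z \<in> points c" for z
    using h(1) equivariant_closed that by (fastforce simp: mem_Hom_PSh X_def)
  have "Arrow c c (fn h) = Id (PSh U M) c"
  proof (rule col_unique)
    show "Arrow c c (fn h) \<in> Hom (PSh U M) c c"
      using h(1) I hI mset_c
      by (auto simp: mem_Hom_PSh equivariant_maps_def PiE_iff X_def)
    show "Comp (PSh U M) (Arrow c c (fn h)) (l j) = l j" if "j \<in> Obj J" for j
      using h(2)[OF that] l_arr[OF that]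
      by (simp add: PSh_sel map_arrow_eq_iff l'_def)
  qed
  then have "fn h y = y" using y by (simp add: PSh_sel map_arrow_eq_iff)
  then show ?thesis using hI[OF y] by (auto simp: I_def)
qed

sublocale fs: filtered_sets J "\<lambda>j. points (FObj D j)" "\<lambda>u. fn (FArr D u)"
  by (rule filtered_sets_PSh[OF J filt D])

text \<open>Germs form an \<open>M\<close>-set \<open>X\<close> receiving a cocone from the diagram.
  This cocone factors through \<open>c\<close>, so points with equal image in \<open>c\<close> have
  equal germs.\<close>

lemma l_detect:
  assumes j: "j \<in> Obj J" and x: "x \<in> points (FObj D j)" "y \<in> points (FObj D j)"
    and eq: "fn (l j) x = fn (l j) y"
  shows "\<exists>k. \<exists>u\<in>Hom J j k. fn (FArr D u) x = fn (FArr D u) y"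
proof -
  define S where "S = Sigma (Obj J) (\<lambda>j. points (FObj D j))"
  define \<alpha> where "\<alpha> = (\<lambda>(j, x) m. (j, act (FObj D j) (x, m)))"
  have S_small: "S \<lesssim> (UNIV :: 'u set)"
  proof -
    \<comment> \<open>The disjoint union \<open>S\<close> consists of pairs over \<open>'u\<close>,
      and an infinite \<open>'u\<close> has room for its own square.\<close>
    obtain f :: "'u \<times> 'u \<Rightarrow> 'u" where "inj f"
      using Times_same_infinite_bij_betw_types[OF inf] by (auto simp: bij_def)
    then show ?thesis by (auto simp: lepoll_def intro: inj_on_subset)
  qed
  obtain q :: "'u \<times> 'u \<Rightarrow> 'u" and X where X: "is_right_mset M X" "points X = q ` S"
    and q: "\<And>y z. y \<in> S \<Longrightarrow> z \<in> S \<Longrightarrow> q y = q z \<longleftrightarrow> (y, z) \<in> fs.germ_eq"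
    and act: "\<And>y m. y \<in> S \<Longrightarrow> m \<in> carrier M \<Longrightarrow> act X (q y, m) = q (\<alpha> y m)"
  proof (rule ex_quotient_mset[OF mon _ S_small])
    show "equiv S fs.germ_eq" unfolding S_def by (rule fs.equiv_germ_eq)
    show "\<alpha> y m \<in> S" if "y \<in> S" "m \<in> carrier M" for y m
      using that act_closed[OF mset_D] by (auto simp: S_def \<alpha>_def)
    show "\<alpha> y \<one>\<^bsub>M\<^esub> = y" if "y \<in> S" for y
      using that mset_D by (auto simp: S_def \<alpha>_def is_right_mset_def)
    show "\<alpha> (\<alpha> y m) n = \<alpha> y (m \<otimes>\<^bsub>M\<^esub> n)" if "y \<in> S" "m \<in> carrier M" "n \<in> carrier M" for y m n
      using that mset_D by (auto simp: S_def \<alpha>_def is_right_mset_def)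
    show "(\<alpha> y m, \<alpha> z m) \<in> fs.germ_eq" if yz: "(y, z) \<in> fs.germ_eq" and m: "m \<in> carrier M" for y z m
    proof -
      obtain i x j x' where e: "y = (i, x)" "z = (j, x')" by (cases y; cases z)
      obtain k u v where uv: "u \<in> Hom J i k" "v \<in> Hom J j k" "fn (FArr D u) x = fn (FArr D v) x'"
        and x: "x \<in> points (FObj D i)" "i \<in> Obj J" "x' \<in> points (FObj D j)" "j \<in> Obj J"
        using yz by (auto simp: fs.germ_eq_def e)
      have "fn (FArr D u) (act (FObj D i) (x, m)) = fn (FArr D v) (act (FObj D j) (x', m))"
        using equivariant_act[OF D_arr(3)[OF uv(1)] x(1) m]
          equivariant_act[OF D_arr(3)[OF uv(2)] x(3) m] uv(3) by simp
      then show ?thesis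
        using uv(1,2) x act_closed[OF mset_D _ m] unfolding fs.germ_eq_def e \<alpha>_def by auto
    qed
  qed blast
  define l' where "l' j = Arrow (FObj D j) X (\<lambda>x\<in>points (FObj D j). q (j, x))" for j
  have l': "l' j \<in> Hom (PSh U M) (FObj D j) X" if j: "j \<in> Obj J" for j
  proof -
    have "q (j, act (FObj D j) (x, m)) = act X (q (j, x), m)"
      if "x \<in> points (FObj D j)" "m \<in> carrier M" for x m
      using act[of "(j, x)" m] that j by (simp add: S_def \<alpha>_def)
    then show ?thesis
      using X mset_D[OF j] act_closed[OF mset_D[OF j]] j
      by (auto simp: l'_def mem_Hom_PSh equivariant_maps_def S_def)
  qed
  have "is_cocone J (PSh U M) D X l'"
  proof (rule is_coconeI[OF J _ l'])
    fix u i j assume u: "u \<in> Hom J i j" "i \<in> Obj J" "j \<in> Obj J"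
    have Dx: "fn (FArr D u) x \<in> points (FObj D j)" if "x \<in> points (FObj D i)" for x
      using equivariant_closed[OF D_arr(3)[OF u(1)] that] .
    have "q (j, fn (FArr D u) x) = q (i, x)" if x: "x \<in> points (FObj D i)" for x
    proof -
      \<comment> \<open>The common stage of the two pairs is \<open>j\<close> itself, reached by the
        identity from \<open>j\<close> and by \<open>u\<close> from \<open>i\<close>.\<close>
      have "fn (FArr D (Id J j)) (fn (FArr D u) x) = fn (FArr D u) x"
        using is_functorD(3)[OF D u(3)] Dx[OF x] by (simp add: PSh_sel)
      then have "((j, fn (FArr D u) x), (i, x)) \<in> fs.germ_eq"
        using u x Dx[OF x] Id_Hom[OF J u(3)] unfolding fs.germ_eq_def by auto
      then show ?thesis using q u x Dx[OF x] by (simp add: S_def)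
    qed
    then show "Comp (PSh U M) (l' j) (FArr D u) = l' i"
      using Dx D_arr[OF u(1)] by (auto simp: l'_def PSh_sel compose_def intro!: restrict_ext)
  qed (simp_all add: PSh_sel X)
  then obtain h where h: "\<And>j. j \<in> Obj J \<Longrightarrow> Comp (PSh U M) h (l j) = l' j"
    using col unfolding is_colimit_def by blast
  have "q (j, z) = fn h (fn (l j) z)" if "z \<in> points (FObj D j)" for z
    using fn_Comp_PSh[of z "l j" U M h] h[OF j] l_arr(1)[OF j] that by (simp add: l'_def)
  then have "((j, x), (j, y)) \<in> fs.germ_eq"
    using q[of "(j, x)" "(j, y)"] x j eq by (simp add: S_def)
  then show ?thesis using fs.germ_eqE by blast
qed

end


section \<open>Stabilisers and fixed points\<close>

text \<open>Right-factorability: if \<open>m\<close> and the product of \<open>m\<close> and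
  \<open>n\<close> both fix \<open>y\<close>, then acting on \<open>y\<close> by \<open>n\<close>
  equals acting by \<open>m\<close> first and then by \<open>n\<close>, which gives \<open>y\<close>
  again.\<close>

lemma stabiliser_rf:
  assumes "monoid M" and X: "is_right_mset M X" and y: "y \<in> points X"
  shows "submonoid {m \<in> carrier M. act X (y, m) = y} M"
    "right_factorable M {m \<in> carrier M. act X (y, m) = y}"
proof -
  interpret monoid M by fact
  have mult: "act X (y, m \<otimes>\<^bsub>M\<^esub> n) = act X (act X (y, m), n)"
    if "m \<in> carrier M" "n \<in> carrier M" for m n
    using X y that by (simp add: is_right_mset_def)
  show "submonoid {m \<in> carrier M. act X (y, m) = y} M"
    using X y by (intro submonoid.intro) (auto simp: mult is_right_mset_def)
  show "right_factorable M {m \<in> carrier M. act X (y, m) = y}"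
    by (auto simp: right_factorable_def mult)
qed

context filtered_diagram
begin

text \<open>Induction on \<open>S\<close>. The equation for a new \<open>s\<close> holds in the
  colimit, hence after some transition map; the equations for earlier elements survive because
  transition maps are equivariant.\<close>

lemma finite_fixed:
  assumes "finite S" "S \<subseteq> carrier M" and z: "z \<in> fixed_points M c"
  shows "\<exists>j\<in>Obj J. \<exists>x\<in>points (FObj D j). fn (l j) x = z \<and> (\<forall>s\<in>S. act (FObj D j) (x, s) = x)"
  using assms(1,2)
proof (induction rule: finite_induct)
  case empty
  then show ?case using l_surj z by (auto simp: fixed_points_def)
next
  case (insert s S)
  then obtain j x where j: "j \<in> Obj J" and x: "x \<in> points (FObj D j)" "fn (l j) x = z"
    "\<And>s. s \<in> S \<Longrightarrow> act (FObj D j) (x, s) = x"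
    by auto
  have s: "s \<in> carrier M" using insert by simp
  have xs: "act (FObj D j) (x, s) \<in> points (FObj D j)"
    using act_closed[OF mset_D[OF j] x(1) s] .
  have "fn (l j) (act (FObj D j) (x, s)) = fn (l j) x"
    using equivariant_act[OF l_arr(3)[OF j] x(1) s] z x(2) s by (simp add: fixed_points_def)
  then obtain k u where u: "u \<in> Hom J j k" "fn (FArr D u) (act (FObj D j) (x, s)) = fn (FArr D u) x"
    using l_detect[OF j xs x(1)] by blast
  have act_u: "act (FObj D k) (fn (FArr D u) x, m) = fn (FArr D u) (act (FObj D j) (x, m))"
    if "m \<in> carrier M" for m
    using equivariant_act[OF D_arr(3)[OF u(1)] x(1) that] by simp
  show ?case
  proof (intro bexI conjI)
    show "fn (l k) (fn (FArr D u) x) = z"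
      using PSh_cocone_compat[OF D c u(1) x(1)] x(2) by simp
    show "\<forall>t\<in>insert s S. act (FObj D k) (fn (FArr D u) x, t) = fn (FArr D u) x"
      using act_u s insert.prems u(2) x(3) by auto
    show "fn (FArr D u) x \<in> points (FObj D k)"
      using equivariant_closed[OF D_arr(3)[OF u(1)] x(1)] .
    show "k \<in> Obj J" using Hom_Obj[OF J u(1)] by simp
  qed
qed

lemma fixed_point_lifts:
  assumes rf: "right_factorably_finitely_generated M" and z: "z \<in> fixed_points M c"
  shows "\<exists>j\<in>Obj J. \<exists>x\<in>fixed_points M (FObj D j). fn (l j) x = z"
proof -
  obtain S where S: "S \<subseteq> carrier M" "finite S" "rf_generated M S = carrier M"
    using rf by (auto simp: right_factorably_finitely_generated_def)
  obtain j x where j: "j \<in> Obj J" and x: "x \<in> points (FObj D j)" "fn (l j) x = z"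
    "\<And>s. s \<in> S \<Longrightarrow> act (FObj D j) (x, s) = x"
    using finite_fixed[OF S(2,1) z] by blast
  \<comment> \<open>The stabiliser of \<open>x\<close> is one of the submonoids over which
    \<open>rf_generated\<close> is the intersection.\<close>
  have "rf_generated M S \<subseteq> {m \<in> carrier M. act (FObj D j) (x, m) = x}"
    using stabiliser_rf[OF mon mset_D[OF j] x(1)] x(3) S(1)
    by (intro rf_generated_least(4)[OF mon S(1)]) auto
  then have "x \<in> fixed_points M (FObj D j)"
    using S(3) x(1) by (auto simp: fixed_points_def)
  then show ?thesis using j x(2) by blast
qed

end

section \<open>Finite generation implies preservation of filtered colimits\<close>

lemma filtered_diagramI:
  fixes U :: "'u itself" and J :: "('u, 'u) category"
  assumes "monoid M" "infinite (UNIV :: 'u set)"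
    "is_category J \<and> filtered J \<and> is_functor J (PSh U M) D \<and> is_colimit J (PSh U M) D c l"
  shows "filtered_diagram U M J D c l"
  using assms by (simp add: filtered_diagram_def)

text \<open>Surjectivity is \<open>fixed_point_lifts\<close>; detection is inherited from the
  underlying points, since global sections act on arrows by restriction.\<close>

lemma global_sections_preserves:
  fixes U :: "'u itself"
  assumes mon: "monoid M" and inf: "infinite (UNIV :: 'u set)"
    and rf: "right_factorably_finitely_generated M"
  shows "preserves_filtered_colimits U (PSh U M) set_category (global_sections U M)"
  unfolding preserves_filtered_colimits_def
proof (intro allI impI)
  fix J :: "('u, 'u) category" and D c l
  assume *: "is_category J \<and> filtered J \<and> is_functor J (PSh U M) D \<and> is_colimit J (PSh U M) D c l"
  interpret filtered_diagram U M J D c l by (rule filtered_diagramI[OF mon inf *])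
  let ?G = "global_sections U M"
  show "is_colimit J set_category (functor_comp ?G D) (FObj ?G c) (\<lambda>j. FArr ?G (l j))"
  proof (rule set_category_colimitI2[OF J filt])
    show "is_functor J set_category (functor_comp ?G D)"
      by (rule is_functor_comp[OF J D is_functor_global_sections])
    show "is_cocone J set_category (functor_comp ?G D) (FObj ?G c) (\<lambda>j. FArr ?G (l j))"
      by (rule functor_cocone[OF J D is_functor_global_sections c])
  next
    fix y assume "y \<in> FObj ?G c"
    then have "y \<in> fixed_points M c" by (simp add: global_sections_def)
    then obtain j x where "j \<in> Obj J" "x \<in> fixed_points M (FObj D j)" "fn (l j) x = y"
      using fixed_point_lifts[OF rf] by blast
    then show "\<exists>j\<in>Obj J. \<exists>x\<in>FObj (functor_comp ?G D) j. fn (FArr ?G (l j)) x = y"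
      using l_arr(1) by (auto simp: global_sections_def functor_comp_def intro!: bexI)
  next
    fix j x y
    assume j: "j \<in> Obj J" and "x \<in> FObj (functor_comp ?G D) j" "y \<in> FObj (functor_comp ?G D) j"
      and eq: "fn (FArr ?G (l j)) x = fn (FArr ?G (l j)) y"
    then have x: "x \<in> fixed_points M (FObj D j)" "y \<in> fixed_points M (FObj D j)"
      by (simp_all add: global_sections_def functor_comp_def)
    have "fn (l j) x = fn (l j) y"
      using eq x l_arr(1)[OF j] by (simp add: global_sections_def)
    then obtain k u where u: "u \<in> Hom J j k" "fn (FArr D u) x = fn (FArr D u) y"
      using l_detect[OF j] x fixed_points_subset by metis
    have "fn (FArr (functor_comp ?G D) u) x = fn (FArr (functor_comp ?G D) u) y"
      using x u(2) D_arr(1)[OF u(1)] by (simp add: global_sections_def functor_comp_def)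
    then show "\<exists>k. \<exists>u\<in>Hom J j k. fn (FArr (functor_comp ?G D) u) x = fn (FArr (functor_comp ?G D) u) y"
      using u(1) by blast
  qed
qed

definition point_arrow :: "'u itself \<Rightarrow> ('m, 'r) monoid_scheme \<Rightarrow> ('u, 'm) right_mset \<Rightarrow> 'u \<Rightarrow>
    (('u, 'm) right_mset, 'u) map_arrow" where
  "point_arrow U M X x = Arrow (terminal_mset U M) X (\<lambda>_\<in>{undefined}. x)"

text \<open>An equivariant map out of the one-point \<open>M\<close>-set is determined by its value
  at \<open>undefined\<close>, and invariance of that point makes the value fixed. With
  \<open>point_arrow_inject\<close> this identifies maps out of \<open>1\<close> with fixed
  points.\<close>

lemma Hom_terminal:
  assumes "monoid M" "is_right_mset M X"
  shows "Hom (PSh U M) (terminal_mset U M) X = point_arrow U M X ` fixed_points M X"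
proof (intro equalityI subsetI)
  have pts: "points (terminal_mset U M) = {undefined}" by (simp add: terminal_mset_def)
  have act: "act (terminal_mset U M) (undefined, m) = undefined" if "m \<in> carrier M" for m
    using that by (simp add: terminal_mset_def)
  have mset: "is_right_mset M (terminal_mset U M)"
    using terminal_mset_terminal(1)[OF assms(1), of U] by (simp add: PSh_sel)
  {
    fix g assume g: "g \<in> Hom (PSh U M) (terminal_mset U M) X"
    then have fg: "fn g \<in> equivariant_maps M (terminal_mset U M) X" by (simp add: mem_Hom_PSh)
    have "act X (fn g undefined, m) = fn g undefined" if "m \<in> carrier M" for m
      using equivariant_act[OF fg _ that, of undefined] act[OF that] pts by simp
    then have "fn g undefined \<in> fixed_points M X"
      using equivariant_closed[OF fg] pts by (simp add: fixed_points_def)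
    moreover have "fn g = (\<lambda>_\<in>{undefined}. fn g undefined)"
      using equivariant_maps_PiE[OF fg] pts by (auto simp: PiE_iff intro: extensionalityI)
    ultimately show "g \<in> point_arrow U M X ` fixed_points M X"
      using g by (auto simp: point_arrow_def mem_Hom_PSh map_arrow_eq_iff)
  next
    fix g assume "g \<in> point_arrow U M X ` fixed_points M X"
    then show "g \<in> Hom (PSh U M) (terminal_mset U M) X"
      using mset assms(2) pts act
      by (auto simp: point_arrow_def mem_Hom_PSh equivariant_maps_def fixed_points_def)
  }
qed

text \<open>Naturality of the identification of fixed points with maps out of
  \<open>1\<close>.\<close>

lemma Comp_point_arrow:
  "Comp (PSh U M) h (point_arrow U M X x) = point_arrow U M (target h) (fn h x)"
  by (auto simp: PSh_sel point_arrow_def map_arrow_eq_iff compose_def terminal_mset_def)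

lemma point_arrow_inject: "point_arrow U M X x = point_arrow U M X y \<longleftrightarrow> x = y"
  by (auto simp: point_arrow_def dest: fun_cong[of _ _ undefined])

text \<open>The proof of \<open>global_sections_preserves\<close>, transported along the bijections
  \<open>point_arrow\<close>.\<close>

lemma terminal_finitely_presentable:
  fixes U :: "'u itself"
  assumes mon: "monoid M" and inf: "infinite (UNIV :: 'u set)"
    and rf: "right_factorably_finitely_generated M"
  shows "finitely_presentable U (PSh U M) (terminal_mset U M)"
  unfolding finitely_presentable_def preserves_filtered_colimits_def
proof (intro allI impI conjI terminal_mset_terminal(1) mon)
  fix J :: "('u, 'u) category" and D c l
  assume *: "is_category J \<and> filtered J \<and> is_functor J (PSh U M) D \<and> is_colimit J (PSh U M) D c l"
  interpret filtered_diagram U M J D c l by (rule filtered_diagramI[OF mon inf *])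
  let ?G = "hom_functor (PSh U M) (terminal_mset U M)"
  have G: "is_functor (PSh U M) set_category ?G"
    by (rule is_functor_hom_functor[OF is_category_PSh terminal_mset_terminal(1)[OF mon]])
  have GX: "FObj ?G X = point_arrow U M X ` fixed_points M X" if "is_right_mset M X" for X
    using Hom_terminal[OF mon that] by (simp add: hom_functor_def)
  have Gh: "fn (FArr ?G h) (point_arrow U M X x) = point_arrow U M (target h) (fn h x)"
    if "is_right_mset M X" "x \<in> fixed_points M X" "source h = X" for h X x
    using Hom_terminal[OF mon that(1), of U] that(2,3)
    by (simp add: hom_functor_def PSh_sel(2) Comp_point_arrow)
  have GD: "FObj (functor_comp ?G D) j = point_arrow U M (FObj D j) ` fixed_points M (FObj D j)"
    if "j \<in> Obj J" for j
    using GX[OF mset_D[OF that]] by (simp add: functor_comp_def)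
  show "is_colimit J set_category (functor_comp ?G D) (FObj ?G c) (\<lambda>j. FArr ?G (l j))"
  proof (rule set_category_colimitI2[OF J filt])
    show "is_functor J set_category (functor_comp ?G D)"
      by (rule is_functor_comp[OF J D G])
    show "is_cocone J set_category (functor_comp ?G D) (FObj ?G c) (\<lambda>j. FArr ?G (l j))"
      by (rule functor_cocone[OF J D G c])
  next
    fix g assume "g \<in> FObj ?G c"
    then obtain y where y: "y \<in> fixed_points M c" "g = point_arrow U M c y"
      using GX[OF mset_c] by auto
    obtain j x where x: "j \<in> Obj J" "x \<in> fixed_points M (FObj D j)" "fn (l j) x = y"
      using fixed_point_lifts[OF rf y(1)] by blast
    have "fn (FArr ?G (l j)) (point_arrow U M (FObj D j) x) = g"
      using Gh[OF mset_D[OF x(1)] x(2) l_arr(1)[OF x(1)]] l_arr(2)[OF x(1)] x(3) y(2) by simp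
    then show "\<exists>j\<in>Obj J. \<exists>x\<in>FObj (functor_comp ?G D) j. fn (FArr ?G (l j)) x = g"
      using x GD by blast
  next
    fix j g g'
    assume j: "j \<in> Obj J" and "g \<in> FObj (functor_comp ?G D) j" "g' \<in> FObj (functor_comp ?G D) j"
      and eq: "fn (FArr ?G (l j)) g = fn (FArr ?G (l j)) g'"
    then obtain x y where x: "x \<in> fixed_points M (FObj D j)" "g = point_arrow U M (FObj D j) x"
      and y: "y \<in> fixed_points M (FObj D j)" "g' = point_arrow U M (FObj D j) y"
      using GD by blast
    note Dj = mset_D[OF j]
    have "fn (l j) x = fn (l j) y"
      using eq Gh[OF Dj x(1) l_arr(1)[OF j]] Gh[OF Dj y(1) l_arr(1)[OF j]] x(2) y(2)
      by (simp add: point_arrow_inject)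
    then obtain k u where u: "u \<in> Hom J j k" "fn (FArr D u) x = fn (FArr D u) y"
      using l_detect[OF j] x(1) y(1) fixed_points_subset by metis
    have "fn (FArr ?G (FArr D u)) g = fn (FArr ?G (FArr D u)) g'"
      using Gh[OF Dj x(1) D_arr(1)[OF u(1)]] Gh[OF Dj y(1) D_arr(1)[OF u(1)]] x(2) y(2) u(2) by simp
    then show "\<exists>k. \<exists>u\<in>Hom J j k. fn (FArr (functor_comp ?G D) u) g = fn (FArr (functor_comp ?G D) u) g'"
      using u(1) by (auto simp: functor_comp_def)
  qed
qed

section \<open>Lifting of fixed points from a colimit to a stage\<close>

text \<open>The surjectivity half of preservation. It follows from preservation by either functor
  and suffices to derive finite generation.\<close>

definition fixed_points_lift :: "'u itself \<Rightarrow> ('m, 'r) monoid_scheme \<Rightarrow> bool" where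
  "fixed_points_lift (U :: 'u itself) M \<longleftrightarrow>
     (\<forall>(J :: ('u, 'u) category) D c l z.
        is_category J \<and> filtered J \<and> is_functor J (PSh U M) D \<and> is_colimit J (PSh U M) D c l \<and>
        z \<in> fixed_points M c \<longrightarrow>
        (\<exists>j\<in>Obj J. \<exists>x\<in>fixed_points M (FObj D j). fn (l j) x = z))"

lemma lift_if_global_sections_preserves:
  fixes U :: "'u itself"
  assumes mon: "monoid M" and inf: "infinite (UNIV :: 'u set)"
    and pres: "preserves_filtered_colimits U (PSh U M) set_category (global_sections U M)"
  shows "fixed_points_lift U M"
  unfolding fixed_points_lift_def
proof (intro allI impI)
  fix J :: "('u, 'u) category" and D c l z
  assume "is_category J \<and> filtered J \<and> is_functor J (PSh U M) D \<and> is_colimit J (PSh U M) D c l \<and>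
    z \<in> fixed_points M c"
  then have *: "is_category J \<and> filtered J \<and> is_functor J (PSh U M) D \<and> is_colimit J (PSh U M) D c l"
    and z: "z \<in> fixed_points M c" by auto
  interpret filtered_diagram U M J D c l by (rule filtered_diagramI[OF mon inf *])
  let ?G = "global_sections U M"
  have "is_colimit J set_category (functor_comp ?G D) (FObj ?G c) (\<lambda>j. FArr ?G (l j))"
    using pres * unfolding preserves_filtered_colimits_def by blast
  moreover have "z \<in> FObj ?G c" using z by (simp add: global_sections_def)
  ultimately obtain j x where j: "j \<in> Obj J" and x: "x \<in> FObj (functor_comp ?G D) j"
    "fn (FArr ?G (l j)) x = z"
    using set_category_colimit_surj[OF J is_functor_comp[OF J D is_functor_global_sections]] by blast
  have "x \<in> fixed_points M (FObj D j)" using x(1) by (simp add: functor_comp_def global_sections_def)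
  moreover from this have "fn (l j) x = z"
    using x(2) l_arr(1)[OF j] by (simp add: global_sections_def)
  ultimately show "\<exists>j\<in>Obj J. \<exists>x\<in>fixed_points M (FObj D j). fn (l j) x = z"
    using j by blast
qed

text \<open>The fixed point \<open>z\<close> becomes an arrow from \<open>1\<close> to
  \<open>c\<close>; it factors through a stage by \<open>set_category_colimit_surj\<close>, and the
  factor is again a \<open>point_arrow\<close>.\<close>

lemma lift_if_finitely_presentable:
  fixes U :: "'u itself"
  assumes mon: "monoid M" and inf: "infinite (UNIV :: 'u set)"
    and fp: "finitely_presentable U (PSh U M) (terminal_mset U M)"
  shows "fixed_points_lift U M"
  unfolding fixed_points_lift_def
proof (intro allI impI)
  fix J :: "('u, 'u) category" and D c l z
  assume "is_category J \<and> filtered J \<and> is_functor J (PSh U M) D \<and> is_colimit J (PSh U M) D c l \<and>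
    z \<in> fixed_points M c"
  then have *: "is_category J \<and> filtered J \<and> is_functor J (PSh U M) D \<and> is_colimit J (PSh U M) D c l"
    and z: "z \<in> fixed_points M c" by auto
  interpret filtered_diagram U M J D c l by (rule filtered_diagramI[OF mon inf *])
  let ?G = "hom_functor (PSh U M) (terminal_mset U M)"
  have G: "is_functor (PSh U M) set_category ?G"
    by (rule is_functor_hom_functor[OF is_category_PSh terminal_mset_terminal(1)[OF mon]])
  have "is_colimit J set_category (functor_comp ?G D) (FObj ?G c) (\<lambda>j. FArr ?G (l j))"
    using fp * unfolding finitely_presentable_def preserves_filtered_colimits_def by blast
  moreover have "point_arrow U M c z \<in> FObj ?G c"
    using Hom_terminal[OF mon mset_c] z by (simp add: hom_functor_def)
  ultimately obtain j g where j: "j \<in> Obj J" and g: "g \<in> FObj (functor_comp ?G D) j"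
    "fn (FArr ?G (l j)) g = point_arrow U M c z"
    using set_category_colimit_surj[OF J is_functor_comp[OF J D G]] by blast
  have g_Hom: "g \<in> Hom (PSh U M) (terminal_mset U M) (FObj D j)"
    using g(1) by (simp add: functor_comp_def hom_functor_def)
  then obtain x where x: "x \<in> fixed_points M (FObj D j)" "g = point_arrow U M (FObj D j) x"
    using Hom_terminal[OF mon mset_D[OF j]] by blast
  have "point_arrow U M c (fn (l j) x) = point_arrow U M c z"
    using g(2) g_Hom x(2) l_arr[OF j]
    by (simp add: hom_functor_def PSh_sel(2) Comp_point_arrow)
  then show "\<exists>j\<in>Obj J. \<exists>x\<in>fixed_points M (FObj D j). fn (l j) x = z"
    using j x(1) by (auto simp: point_arrow_inject)
qed


section \<open>The terminal \<open>M\<close>-set as a filtered colimit of quotients of \<open>M\<close>\<close>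

text \<open>
  The largest right congruence having a given right-factorable submonoid \<open>T\<close> as a class need not
  be monotone in \<open>T\<close>; intersecting them over all \<open>T \<supseteq> F\<close> makes the dependence on \<open>F\<close> monotone.
\<close>

definition rf_congruence :: "('m, 'r) monoid_scheme \<Rightarrow> 'm set \<Rightarrow> ('m \<times> 'm) set" where
  "rf_congruence M F = {(a, b). a \<in> carrier M \<and> b \<in> carrier M \<and>
     (\<forall>T. submonoid T M \<and> right_factorable M T \<and> F \<subseteq> T \<longrightarrow>
        (\<forall>n\<in>carrier M. a \<otimes>\<^bsub>M\<^esub> n \<in> T \<longleftrightarrow> b \<otimes>\<^bsub>M\<^esub> n \<in> T))}"

lemma equiv_rf_congruence: "equiv (carrier M) (rf_congruence M F)"
  by (intro equivI refl_onI symI transI) (auto simp: rf_congruence_def)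

text \<open>Fewer submonoids contain the larger set, so fewer conditions are imposed. This yields
  the transition maps between the quotients.\<close>

lemma rf_congruence_mono: "F \<subseteq> G \<Longrightarrow> rf_congruence M F \<subseteq> rf_congruence M G"
  unfolding rf_congruence_def by blast

text \<open>Testing the multiplied pair at \<open>n\<close> is testing the original pair at the
  product of \<open>m\<close> and \<open>n\<close>; the quantifier over \<open>n\<close> in the
  definition serves this purpose.\<close>

lemma rf_congruence_mult:
  assumes "monoid M" "(a, b) \<in> rf_congruence M F" "m \<in> carrier M"
  shows "(a \<otimes>\<^bsub>M\<^esub> m, b \<otimes>\<^bsub>M\<^esub> m) \<in> rf_congruence M F"
proof -
  interpret monoid M by fact
  show ?thesis using assms(2,3) by (auto simp: rf_congruence_def m_assoc)
qed

text \<open>For \<open>a\<close> in \<open>T\<close>, multiplying on the left by \<open>a\<close>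
  preserves membership in \<open>T\<close> by closure and reflects it by
  right-factorability.\<close>

lemma rf_congruence_one:
  assumes "monoid M" and a: "a \<in> carrier M" "a \<in> F"
  shows "(a, \<one>\<^bsub>M\<^esub>) \<in> rf_congruence M F"
proof -
  interpret monoid M by fact
  have "a \<otimes>\<^bsub>M\<^esub> n \<in> T \<longleftrightarrow> n \<in> T"
    if "submonoid T M" "right_factorable M T" "F \<subseteq> T" "n \<in> carrier M" for T n
    using that a by (auto simp: right_factorable_def intro: submonoid.m_closed)
  then show ?thesis using a by (simp add: rf_congruence_def)
qed

text \<open>The congruence is tested on the submonoid generated by \<open>F\<close> and
  \<open>m\<close>, at the unit: it contains \<open>m\<close>, hence also the product of
  \<open>m\<close> and \<open>n\<close>, hence \<open>n\<close>.\<close>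

lemma rf_congruence_absorb:
  assumes "monoid M" and F: "F \<subseteq> carrier M" and m: "m \<in> carrier M" and n: "n \<in> carrier M"
    and rel: "(m \<otimes>\<^bsub>M\<^esub> n, m) \<in> rf_congruence M F"
  shows "n \<in> rf_generated M (insert m F)"
proof -
  interpret monoid M by fact
  define T where "T = rf_generated M (insert m F)"
  have T: "submonoid T M" "right_factorable M T" "insert m F \<subseteq> T"
    using rf_generated_least(1-3)[OF assms(1), of "insert m F"] F m by (auto simp: T_def)
  have "m \<otimes>\<^bsub>M\<^esub> n \<otimes>\<^bsub>M\<^esub> \<one>\<^bsub>M\<^esub> \<in> T \<longleftrightarrow> m \<otimes>\<^bsub>M\<^esub> \<one>\<^bsub>M\<^esub> \<in> T"
    using rel T one_closed unfolding rf_congruence_def by blast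
  then have "m \<otimes>\<^bsub>M\<^esub> n \<in> T" using T(3) m n by simp
  then have "n \<in> T" using T(2,3) n unfolding right_factorable_def by blast
  then show ?thesis by (simp add: T_def)
qed

section \<open>A small category of finite subsets\<close>

text \<open>Preservation is tested only on index categories with objects and arrows in
  \<open>'u\<close>, so inclusion of finite subsets is encoded there. An infinite \<open>'u\<close>
  is in bijection with its finite subsets and with its square.\<close>

lemma ex_finite_subset_category:
  fixes A :: "'a set"
  assumes inf: "infinite (UNIV :: 'u set)" and small: "A \<lesssim> (UNIV :: 'u set)"
  obtains J :: "('u, 'u) category" and S :: "'u \<Rightarrow> 'a set"
  where "is_category J" "filtered J" "Obj J = UNIV"
    "\<And>i. finite (S i)" "\<And>i. S i \<subseteq> A" "\<And>F. finite F \<Longrightarrow> F \<subseteq> A \<Longrightarrow> \<exists>i. S i = F"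
    "\<And>i j. Hom J i j \<noteq> {} \<longleftrightarrow> S i \<subseteq> S j"
proof -
  obtain \<iota> :: "'a \<Rightarrow> 'u" where \<iota>: "inj_on \<iota> A" using small by (auto simp: lepoll_def)
  obtain g :: "'u \<Rightarrow> 'u set" where g: "bij_betw g UNIV (Fpow UNIV)"
    using Fpow_infinite_bij_betw[OF inf] bij_betw_inv by blast
  obtain e :: "'u \<times> 'u \<Rightarrow> 'u" where e: "bij e"
    using Times_same_infinite_bij_betw_types[OF inf] by blast
  define p where "p = inv_into UNIV e"
  have p: "p (e x) = x" "e (p u) = u" for x u
    using e by (simp_all add: p_def bij_is_inj bij_is_surj surj_f_inv_f)
  \<comment> \<open>Several indices may decode to the same subset, so the category is a preorder
    rather than a poset.\<close>
  define S where "S u = \<iota> -` g u \<inter> A" for u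
  have fin: "finite (S u)" for u
  proof -
    have "g u \<in> Fpow UNIV" using g by (auto simp: bij_betw_def)
    then show ?thesis using finite_vimage_IntI[OF _ \<iota>] by (simp add: S_def Fpow_def)
  qed
  have S_surj: "\<exists>u. S u = F" if "finite F" "F \<subseteq> A" for F
  proof -
    have "\<iota> ` F \<in> Fpow UNIV" using that by (simp add: Fpow_def)
    then obtain u where "g u = \<iota> ` F" using g unfolding bij_betw_def by (metis imageE)
    then have "S u = F" using \<iota> that by (auto simp: S_def inj_on_def)
    then show ?thesis ..
  qed
  \<comment> \<open>An arrow is the code of its pair of end points, so parallel arrows are equal and
    coequalizing is trivial.\<close>
  define J :: "('u, 'u) category" where
    "J = \<lparr>Obj = UNIV, Arr = {a. S (fst (p a)) \<subseteq> S (snd (p a))},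
       Dom = \<lambda>a. fst (p a), Cod = \<lambda>a. snd (p a), Id = \<lambda>u. e (u, u),
       Comp = \<lambda>b a. e (fst (p a), snd (p b))\<rparr>"
  have Hom: "a \<in> Hom J i j \<longleftrightarrow> a = e (i, j) \<and> S i \<subseteq> S j" for a i j
    using p by (auto simp: Hom_def J_def)
  have cat: "is_category J"
    unfolding is_category_def Hom by (simp add: J_def p) (metis subset_trans)
  have "filtered J"
    unfolding filtered_def
  proof (intro conjI ballI)
    fix i j
    obtain k where "S k = S i \<union> S j" using S_surj[of "S i \<union> S j"] fin by (auto simp: S_def)
    then show "\<exists>k\<in>Obj J. Hom J i k \<noteq> {} \<and> Hom J j k \<noteq> {}"
      using Hom by (intro bexI[of _ k]) (auto simp: J_def)
    fix u v assume "u \<in> Hom J i j" "v \<in> Hom J i j"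
    then have "u = v" by (simp add: Hom)
    then show "\<exists>k\<in>Obj J. \<exists>w\<in>Hom J j k. Comp J w u = Comp J w v"
      using Id_Hom[OF cat, of j] by (auto simp: J_def)
  qed (simp add: J_def)
  moreover have "Obj J = UNIV" by (simp add: J_def)
  moreover have "S i \<subseteq> A" for i by (simp add: S_def)
  moreover have "Hom J i j \<noteq> {} \<longleftrightarrow> S i \<subseteq> S j" for i j
    using Hom by blast
  ultimately show thesis
    using cat fin S_surj by (intro that[of J S])
qed

lemma rf_finitely_generated_if_lift:
  fixes U :: "'u itself" and M :: "('m, 'r) monoid_scheme"
  assumes mon: "monoid M" and inf: "infinite (UNIV :: 'u set)"
    and small: "carrier M \<lesssim> (UNIV :: 'u set)" and lift: "fixed_points_lift U M"
  shows "right_factorably_finitely_generated M"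
proof -
  interpret monoid M by fact
  obtain J :: "('u, 'u) category" and S :: "'u \<Rightarrow> 'm set"
    where J: "is_category J" "filtered J" and Obj: "Obj J = UNIV"
    and S: "\<And>i. finite (S i)" "\<And>i. S i \<subseteq> carrier M"
      "\<And>F. finite F \<Longrightarrow> F \<subseteq> carrier M \<Longrightarrow> \<exists>i. S i = F"
    and Hom: "\<And>i j. Hom J i j \<noteq> {} \<longleftrightarrow> S i \<subseteq> S j"
    using ex_finite_subset_category[OF inf small] by metis
  define R where "R i = rf_congruence M (S i)" for i
  \<comment> \<open>The existential form allows \<open>q\<close> and \<open>X\<close> to be chosen
    for all \<open>i\<close> at once.\<close>
  have "\<exists>(q :: 'm \<Rightarrow> 'u) X. is_right_mset M X \<and> points X = q ` carrier M \<and>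
      (\<forall>a\<in>carrier M. \<forall>b\<in>carrier M. q a = q b \<longleftrightarrow> (a, b) \<in> R i) \<and>
      (\<forall>a\<in>carrier M. \<forall>m\<in>carrier M. act X (q a, m) = q (a \<otimes>\<^bsub>M\<^esub> m))" for i
  proof (rule ex_quotient_mset[OF mon equiv_rf_congruence[of M "S i"] small,
        where \<alpha> = "\<lambda>a m. a \<otimes>\<^bsub>M\<^esub> m"])
    fix q :: "'m \<Rightarrow> 'u" and X
    assume "is_right_mset M X" "points X = q ` carrier M"
      "\<And>a b. a \<in> carrier M \<Longrightarrow> b \<in> carrier M \<Longrightarrow> q a = q b \<longleftrightarrow> (a, b) \<in> rf_congruence M (S i)"
      "\<And>a m. a \<in> carrier M \<Longrightarrow> m \<in> carrier M \<Longrightarrow> act X (q a, m) = q (a \<otimes>\<^bsub>M\<^esub> m)"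
    then show ?thesis by (intro exI[of _ q] exI[of _ X]) (simp add: R_def)
  qed (simp_all add: m_assoc rf_congruence_mult[OF mon])
  then obtain q :: "'u \<Rightarrow> 'm \<Rightarrow> 'u" and X :: "'u \<Rightarrow> ('u, 'm) right_mset"
    where X: "\<And>i. is_right_mset M (X i)" "\<And>i. points (X i) = q i ` carrier M"
    and q: "\<And>i a b. a \<in> carrier M \<Longrightarrow> b \<in> carrier M \<Longrightarrow> q i a = q i b \<longleftrightarrow> (a, b) \<in> R i"
    and act: "\<And>i a m. a \<in> carrier M \<Longrightarrow> m \<in> carrier M \<Longrightarrow> act (X i) (q i a, m) = q i (a \<otimes>\<^bsub>M\<^esub> m)"
    by metis
  \<comment> \<open>Representatives serve to write the transition map from \<open>i\<close> to
    \<open>j\<close> as a function of points; \<open>D_q\<close> shows that it sends the class of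
    \<open>a\<close> to the class of \<open>a\<close>.\<close>
  define r where "r i x = (SOME a. a \<in> carrier M \<and> q i a = x)" for i x
  have r: "r i (q i a) \<in> carrier M" "q i (r i (q i a)) = q i a" if "a \<in> carrier M" for i a
    using someI[of "\<lambda>b. b \<in> carrier M \<and> q i b = q i a" a] that by (auto simp: r_def)
  define D :: "('u, 'u, ('u, 'm) right_mset, (('u, 'm) right_mset, 'u) map_arrow) cat_map" where
    "D = \<lparr>FObj = X, FArr = \<lambda>u. Arrow (X (Dom J u)) (X (Cod J u))
       (\<lambda>x\<in>points (X (Dom J u)). q (Cod J u) (r (Dom J u) x))\<rparr>"
  have D_q: "fn (FArr D u) (q i a) = q j a" if u: "u \<in> Hom J i j" and a: "a \<in> carrier M" for u i j a
  proof -
    have "R i \<subseteq> R j" using Hom u by (auto simp: R_def intro!: rf_congruence_mono)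
    then have "q j (r i (q i a)) = q j a" using q r[OF a] a by blast
    then show ?thesis using HomD[OF u] X(2) a by (simp add: D_def)
  qed
  have D_Hom: "FArr D u \<in> Hom (PSh U M) (X i) (X j)" if u: "u \<in> Hom J i j" for u i j
  proof -
    have "fn (FArr D u) \<in> equivariant_maps M (X i) (X j)"
      using HomD[OF u] r(1) D_q[OF u] by (auto simp: equivariant_maps_def X(2) act) (auto simp: D_def X(2))
    then show ?thesis using HomD[OF u] X(1) by (simp add: mem_Hom_PSh D_def)
  qed
  have X_Obj: "X i \<in> Obj (PSh U M)" for i using X(1) by (simp add: PSh_sel)
  have H: "u \<in> Hom J (Dom J u) (Cod J u)" if "u \<in> Arr J" for u using that by (simp add: Hom_def)
  have D: "is_functor J (PSh U M) D"
    unfolding is_functor_def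
  proof (intro conjI ballI impI)
    show "FArr D u \<in> Hom (PSh U M) (FObj D (Dom J u)) (FObj D (Cod J u))" if "u \<in> Arr J" for u
      using D_Hom[OF H[OF that]] by (simp add: D_def)
    fix i
    show "FArr D (Id J i) = Id (PSh U M) (FObj D i)"
    proof (rule PSh_arrow_eqI)
      show "FArr D (Id J i) \<in> Hom (PSh U M) (X i) (X i)"
        using D_Hom[OF Id_Hom[OF J(1)]] Obj by simp
      show "Id (PSh U M) (FObj D i) \<in> Hom (PSh U M) (X i) (X i)"
        using Id_Hom[OF is_category_PSh X_Obj] by (simp add: D_def)
      show "fn (FArr D (Id J i)) x = fn (Id (PSh U M) (FObj D i)) x" if "x \<in> points (X i)" for x
        \<comment> \<open>Only the object part of \<open>D\<close> is unfolded here, so that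
          \<open>FArr D\<close> keeps the form to which \<open>D_q\<close> applies.\<close>
        using that D_q[OF Id_Hom[OF J(1)]] Obj by (auto simp: X(2) PSh_sel D_def[THEN arg_cong[of _ _ FObj]])
    qed
  next
    fix u v assume "u \<in> Arr J" "v \<in> Arr J" and eq: "Cod J u = Dom J v"
    then have u: "u \<in> Hom J (Dom J u) (Dom J v)" and v: "v \<in> Hom J (Dom J v) (Cod J v)"
      using H by metis+
    have Du: "source (FArr D u) = X (Dom J u)" by (simp add: D_def)
    show "FArr D (Comp J v u) = Comp (PSh U M) (FArr D v) (FArr D u)"
    proof (rule PSh_arrow_eqI)
      show "FArr D (Comp J v u) \<in> Hom (PSh U M) (X (Dom J u)) (X (Cod J v))"
        using D_Hom[OF Comp_Hom[OF J(1) u v]] .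
      show "Comp (PSh U M) (FArr D v) (FArr D u) \<in> Hom (PSh U M) (X (Dom J u)) (X (Cod J v))"
        using Comp_Hom[OF is_category_PSh D_Hom[OF u] D_Hom[OF v]] .
      fix x assume x: "x \<in> points (X (Dom J u))"
      then obtain a where "a \<in> carrier M" "x = q (Dom J u) a" by (auto simp: X(2))
      then show "fn (FArr D (Comp J v u)) x = fn (Comp (PSh U M) (FArr D v) (FArr D u)) x"
        using D_q[OF u] D_q[OF v] D_q[OF Comp_Hom[OF J(1) u v]] fn_Comp_PSh[of x "FArr D u" U M "FArr D v"]
          x Du by simp
    qed
  qed (simp add: X_Obj D_def)
  let ?t = "terminal_mset U M"
  define l where "l i = Arrow (X i) ?t (\<lambda>_\<in>points (X i). undefined)" for i :: 'u
  have t: "?t \<in> Obj (PSh U M)" by (rule terminal_mset_terminal(1)[OF mon])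
  have l: "l i \<in> Hom (PSh U M) (X i) ?t" for i
    using t X(1)[of i] act_closed[OF X(1)]
    by (auto simp: l_def mem_Hom_PSh PSh_sel equivariant_maps_def terminal_mset_def)
  have cocone: "is_cocone J (PSh U M) D ?t l"
  proof (rule is_coconeI[OF J(1) t])
    show "l j \<in> Hom (PSh U M) (FObj D j) ?t" for j using l by (simp add: D_def)
    show "Comp (PSh U M) (l j) (FArr D u) = l i" if u: "u \<in> Hom J i j" for u i j
      using terminal_mset_terminal(2)[OF mon X_Obj[of i]] Comp_Hom[OF is_category_PSh D_Hom[OF u] l] l
      by blast
  qed
  interpret fs: filtered_sets J "\<lambda>j. points (FObj D j)" "\<lambda>u. fn (FArr D u)"
    by (rule filtered_sets_PSh[OF J D])
  have "is_colimit J (PSh U M) D ?t l"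
  proof (rule PSh_colimitI[OF J(1) D cocone])
    show "concrete_colimit J (\<lambda>j. points (FObj D j)) (\<lambda>u. fn (FArr D u)) (points ?t) (\<lambda>j. fn (l j))"
    proof
      show "fn (l j) x \<in> points ?t" if "x \<in> points (FObj D j)" for j x
        using that by (simp add: D_def l_def terminal_mset_def)
      show "fn (l j) (fn (FArr D u) x) = fn (l i) x"
        if "u \<in> Hom J i j" "x \<in> points (FObj D i)" for u i j x
        using PSh_cocone_compat[OF D cocone that] .
      show "\<exists>j\<in>Obj J. \<exists>x\<in>points (FObj D j). fn (l j) x = y" if "y \<in> points ?t" for y
        using that Obj by (auto simp: l_def terminal_mset_def D_def X(2) intro!: exI[of _ "\<one>\<^bsub>M\<^esub>"])
    next
      fix j x y assume "x \<in> points (FObj D j)" "y \<in> points (FObj D j)"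
      then obtain a b where a: "a \<in> carrier M" "x = q j a" and b: "b \<in> carrier M" "y = q j b"
        by (auto simp: D_def X(2))
      \<comment> \<open>Adding \<open>a\<close> and \<open>b\<close> to the finite set identifies
        both classes with that of the unit, which is why the colimit collapses to one point.\<close>
      obtain k where k: "S k = S j \<union> {a, b}"
        using S(3)[of "S j \<union> {a, b}"] S(1,2) a(1) b(1) by auto
      then obtain u where u: "u \<in> Hom J j k" using Hom[of j k] by auto
      have "q k a = q k \<one>\<^bsub>M\<^esub>" "q k b = q k \<one>\<^bsub>M\<^esub>"
        using rf_congruence_one[OF mon, of _ "S k"] k a(1) b(1) by (simp_all add: q R_def)
      then have "fn (FArr D u) x = fn (FArr D u) y"
        using D_q[OF u] a b by simp
      then show "\<exists>k. \<exists>u\<in>Hom J j k. fn (FArr D u) x = fn (FArr D u) y"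
        using u by blast
    qed
  qed
  moreover have "undefined \<in> fixed_points M ?t"
    by (simp add: fixed_points_def terminal_mset_def)
  ultimately obtain i x where x: "x \<in> fixed_points M (FObj D i)"
    using lift J D unfolding fixed_points_lift_def by blast
  then obtain m where m: "m \<in> carrier M" "x = q i m"
    by (auto simp: fixed_points_def D_def X(2))
  \<comment> \<open>The lifted point is the class of some \<open>m\<close>, and its invariance puts
    every \<open>n\<close> in the scope of \<open>rf_congruence_absorb\<close>.\<close>
  have "(m \<otimes>\<^bsub>M\<^esub> n, m) \<in> R i" if "n \<in> carrier M" for n
  proof -
    have "act (X i) (q i m, n) = q i m" using x m(2) that by (simp add: fixed_points_def D_def)
    then have "q i (m \<otimes>\<^bsub>M\<^esub> n) = q i m" using act[OF m(1) that] by simp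
    then show ?thesis using q[of "m \<otimes>\<^bsub>M\<^esub> n" m i] m(1) that by simp
  qed
  then have "carrier M \<subseteq> rf_generated M (insert m (S i))"
    using rf_congruence_absorb[OF mon S(2) m(1)] by (auto simp: R_def)
  moreover have "insert m (S i) \<subseteq> carrier M" using m(1) S(2) by simp
  moreover have "rf_generated M (insert m (S i)) \<subseteq> carrier M"
    using rf_generated_least(2)[OF mon \<open>insert m (S i) \<subseteq> carrier M\<close>]
    by (simp add: right_factorable_def)
  \<comment> \<open>Inserting \<open>m\<close> also makes the generating set nonempty.\<close>
  ultimately show ?thesis
    unfolding right_factorably_finitely_generated_def using S(1)[of i]
    by (intro exI[of _ "insert m (S i)"]) auto
qed

text \<open>Infinity of \<open>'u\<close> gives room for disjoint unions of stages and for the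
  category of finite subsets; the bound on the carrier lets the quotients of \<open>M\<close> be
  objects of \<open>PSh\<close>.\<close>

theorem theorem2p13:
  fixes M :: "('m, 'r) monoid_scheme"
  assumes "monoid M"
    and "infinite (UNIV :: 'u set)"
    and "carrier M \<lesssim> (UNIV :: 'u set)"
  shows "(preserves_filtered_colimits TYPE('u) (PSh TYPE('u) M) set_category
            (global_sections TYPE('u) M)
          \<longleftrightarrow> finitely_presentable TYPE('u) (PSh TYPE('u) M) (terminal_mset TYPE('u) M))
       \<and> (finitely_presentable TYPE('u) (PSh TYPE('u) M) (terminal_mset TYPE('u) M)
          \<longleftrightarrow> right_factorably_finitely_generated M)"
  using global_sections_preserves[OF assms(1,2)] terminal_finitely_presentable[OF assms(1,2)]
    lift_if_global_sections_preserves[OF assms(1,2)] lift_if_finitely_presentable[OF assms(1,2)]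
    rf_finitely_generated_if_lift[OF assms]
  by blast

end
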